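(* Fix $d>0$, a finite set $\Omega$, an integer $k\geq 3$, a finite nonempty set $\Psi$ of functions $\Omega^k\to(0,\infty)$ and a probability distribution $\rho$ on $\Psi$, and let $\mathbf G_n=\mathbf G_n(d,\Omega,k,\Psi,\rho)$ be the Poisson random factor graph. Assume the static replica symmetry condition $$\lim_{n\to\infty}\frac1{n^2}\sum_{i,j=1}^n\mathbb E\left\|\mu_{\mathbf G_n,x_i,x_j}-\mu_{\mathbf G_n,x_i}\otimes\mu_{\mathbf G_n,x_j}\right\|_{TV}=0 .$$ Then there is a sequence $(\varepsilon_n)_n$ with $\varepsilon_n\to0$ such that, with probability tending to $1$ as $n\to\infty$, the family of messages $(\mu_{\mathbf G_n,x\to a},\mu_{\mathbf G_n,a\to x})_{x\in V(\mathbf G_n),a\in\partial x}$ is an $\varepsilon_n$-Belief Propagation fixed point on $\mathbf G_n$.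
   Context: Factor graphs: Fix a finite set $\Omega$ of spins. A factor graph $G$ consists of a finite set $V(G)$ of variable nodes, a finite set $F(G)$ of constraint nodes, for each $a\in F(G)$ an ordered tuple $\partial a=(y_1,\ldots,y_{d(a)})$ of variable nodes, and a weight function $\psi_a:\Omega^{d(a)}\to(0,\infty)$. For $x\in V(G)$ let $\partial x$ be the set of $a\in F(G)$ with $x$ appearing in $\partial a$; we also write $\partial a$ for the set of variable nodes appearing in the tuple. For $\tau\in\Omega^{\partial a}$ (an assignment of spins to the variables of $\partial a$) write $\psi_a(\tau)=\psi_a(\tau(y_1),\ldots,\tau(y_{d(a)}))$. The Gibbs measure is $\mu_G(\sigma)=Z_G^{-1}\prod_{a\in F(G)}\psi_a(\sigma(\partial a))$ for $\sigma\in\Omega^{V(G)}$, where $Z_G=\sum_{\sigma\in\Omega^{V(G)}}\prod_{a}\psi_a(\sigma(\partial a))$ is the partition function. $\mu_{G,x}$ denotes the marginal distribution of $\sigma(x)$ under $\mu_G$ and $\mu_{G,x,y}$ the joint distribution of $(\sigma(x),\sigma(y))$. For $x\in\partial a$ the message $\mu_{G,x\to a}\in\mathcal P(\Omega)$ is the marginal of $x$ in the Gibbs measure of the factor graph $G-a$ obtained by deleting the constraint node $a$, and $\mu_{G,a\to x}$ is the marginal of $x$ in the Gibbs measure of the factor graph obtained from $G$ by deleting all constraint nodes $b\in\partial x\setminus\{a\}$. $\|\cdot\|_{TV}$ is total variation distance. $\varepsilon$-BP fixed point: For a factor graph $G$ with $n$ variable nodes, the messages form an $\varepsilon$-Belief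 Propagation fixed point if $$\sum_{x\in V(G)}\sum_{a\in\partial x}\sum_{\sigma\in\Omega}\left|\mu_{G,x\to a}(\sigma)-\frac{\prod_{b\in\partial x\setminus a}\mu_{G,b\to x}(\sigma)}{\sum_{\tau\in\Omega}\prod_{b\in\partial x\setminus a}\mu_{G,b\to x}(\tau)}\right|+\left|\mu_{G,a\to x}(\sigma)-\frac{\sum_{\tau\in\Omega^{\partial a}}\mathbf 1\{\tau(x)=\sigma\}\psi_a(\tau)\prod_{y\in\partial a\setminus x}\mu_{G,y\to a}(\tau(y))}{\sum_{\tau\in\Omega^{\partial a}}\psi_a(\tau)\prod_{y\in\partial a\setminus x}\mu_{G,y\to a}(\tau(y))}\right|<\varepsilon n.$$ Poisson random factor graph $\mathbf G_n(d,\Omega,k,\Psi,\rho)$: variable nodes $x_1,\ldots,x_n$; constraint nodes $a_1,\ldots,a_m$ where $m$ is Poisson with mean $dn/k$; independently for each $i$, $\psi_{a_i}\in\Psi$ is drawn from $\rho$ and $\partial a_i$ is a uniformly random $k$-tuple in $\{x_1,\ldots,x_n\}^k$. The parameters $d,\Omega,k,\Psi,\rho$ are fixed as $n\to\infty$. Expectations $\mathbb E$ are over the random factor graph. *)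

theory Defs
  imports "HOL-Probability.Probability"
begin

text \<open>Conventions.
  Spins: a finite type 'o (the finite set Omega).
  A weight function psi : Omega^k -> (0,inf) is a function on spin lists ('o list => real);
  only its values on lists of length k matter.
  A factor graph on the variable nodes x_0,...,x_{n-1} (represented by 0..<n) is a list of
  constraint nodes; constraint node number i is the pair (psi_a, tuple of variable nodes).
  Spin configurations are elements of the PiE set {..<n} ->E UNIV.\<close>

type_synonym 'o weight = "'o list \<Rightarrow> real"
type_synonym 'o fgraph = "('o weight \<times> nat list) list"

definition configs :: "nat \<Rightarrow> (nat \<Rightarrow> 'o) set" where
  "configs n = PiE {..<n} (\<lambda>_. UNIV)"

definition weight_of :: "'o fgraph \<Rightarrow> (nat \<Rightarrow> 'o) \<Rightarrow> real" where
  "weight_of G \<sigma> = prod_list (map (\<lambda>(\<psi>, ys). \<psi> (map \<sigma> ys)) G)"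

definition partition_fun :: "nat \<Rightarrow> 'o fgraph \<Rightarrow> real" where
  "partition_fun n G = (\<Sum>\<sigma>\<in>configs n. weight_of G \<sigma>)"

definition gibbs :: "nat \<Rightarrow> 'o fgraph \<Rightarrow> (nat \<Rightarrow> 'o) \<Rightarrow> real" where
  "gibbs n G \<sigma> = weight_of G \<sigma> / partition_fun n G"

definition marg :: "nat \<Rightarrow> 'o fgraph \<Rightarrow> nat \<Rightarrow> 'o \<Rightarrow> real" where
  "marg n G x s = (\<Sum>\<sigma>\<in>configs n. if \<sigma> x = s then gibbs n G \<sigma> else 0)"

definition marg2 :: "nat \<Rightarrow> 'o fgraph \<Rightarrow> nat \<Rightarrow> nat \<Rightarrow> 'o \<times> 'o \<Rightarrow> real" where
  "marg2 n G x y st = (\<Sum>\<sigma>\<in>configs n. if (\<sigma> x, \<sigma> y) = st then gibbs n G \<sigma> else 0)"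

definition tv_dist :: "('a::finite \<Rightarrow> real) \<Rightarrow> ('a \<Rightarrow> real) \<Rightarrow> real" where
  "tv_dist p q = (\<Sum>z\<in>UNIV. \<bar>p z - q z\<bar>) / 2"

definition adj_var :: "'o fgraph \<Rightarrow> nat \<Rightarrow> nat set" where
  "adj_var G x = {i. i < length G \<and> x \<in> set (snd (G ! i))}"

definition vars_of :: "'o fgraph \<Rightarrow> nat \<Rightarrow> nat set" where
  "vars_of G a = set (snd (G ! a))"

definition del_constraints :: "'o fgraph \<Rightarrow> nat set \<Rightarrow> 'o fgraph" where
  "del_constraints G D = map (\<lambda>i. G ! i) (filter (\<lambda>i. i \<notin> D) [0..<length G])"

definition msg_va :: "nat \<Rightarrow> 'o fgraph \<Rightarrow> nat \<Rightarrow> nat \<Rightarrow> 'o \<Rightarrow> real" where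
  "msg_va n G x a = marg n (del_constraints G {a}) x"

definition msg_av :: "nat \<Rightarrow> 'o fgraph \<Rightarrow> nat \<Rightarrow> nat \<Rightarrow> 'o \<Rightarrow> real" where
  "msg_av n G a x = marg n (del_constraints G (adj_var G x - {a})) x"

definition bp_error :: "nat \<Rightarrow> 'o::finite fgraph \<Rightarrow> real" where
  "bp_error n G =
    (\<Sum>x\<in>{..<n}. \<Sum>a\<in>adj_var G x. \<Sum>s\<in>(UNIV::'o set).
       \<bar>msg_va n G x a s
         - (\<Prod>b\<in>adj_var G x - {a}. msg_av n G b x s)
           / (\<Sum>t\<in>UNIV. \<Prod>b\<in>adj_var G x - {a}. msg_av n G b x t)\<bar>
     + \<bar>msg_av n G a x s
         - (\<Sum>\<tau>\<in>PiE (vars_of G a) (\<lambda>_. UNIV).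
              (if \<tau> x = s then fst (G ! a) (map \<tau> (snd (G ! a))) *
                 (\<Prod>y\<in>vars_of G a - {x}. msg_va n G y a (\<tau> y)) else 0))
           / (\<Sum>\<tau>\<in>PiE (vars_of G a) (\<lambda>_. UNIV).
               fst (G ! a) (map \<tau> (snd (G ! a))) *
                 (\<Prod>y\<in>vars_of G a - {x}. msg_va n G y a (\<tau> y)))\<bar>)"

definition is_eps_BP_fixed_point :: "nat \<Rightarrow> 'o::finite fgraph \<Rightarrow> real \<Rightarrow> bool" where
  "is_eps_BP_fixed_point n G \<epsilon> \<longleftrightarrow> bp_error n G < \<epsilon> * real n"

definition random_tuple :: "nat \<Rightarrow> nat \<Rightarrow> nat list pmf" where
  "random_tuple n k = pmf_of_set {ys. length ys = k \<and> set ys \<subseteq> {..<n}}"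

definition random_fgraph :: "real \<Rightarrow> nat \<Rightarrow> 'o weight pmf \<Rightarrow> nat \<Rightarrow> 'o fgraph pmf" where
  "random_fgraph d k \<rho> n =
     bind_pmf (poisson_pmf (d * real n / real k))
       (\<lambda>m. replicate_pmf m (pair_pmf \<rho> (random_tuple n k)))"

end

theory Submission
  imports Defs
begin

text \<open>
  Fix a variable \<open>x\<close>. In the Poisson model the constraints touching \<open>x\<close> are independent of the
  rest \<open>G\<close> of the graph, and in \<open>G\<close> the variable \<open>x\<close> is isolated. A sample of this rest is a sample of
  the whole graph on the event that no constraint touches \<open>x\<close>, which has probability bounded away from 0,
  so \<open>G\<close> inherits replica symmetry. All messages at \<open>x\<close> are averages under \<open>\<mu>\<close>, the Gibbs measure of \<open>G\<close>,
  of products of the few weights attached at \<open>x\<close>, and the Belief Propagation equations hold exactly if the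
  other variables in these constraints are independent under \<open>\<mu>\<close>. Those variables are uniformly random
  given \<open>G\<close>.

  Pairwise decorrelation suffices because of a Bessel-type inequality: if \<open>\<bar>F\<bar> \<le> K\<close>, then the average over
  \<open>y\<close> of \<open>\<bar>Cov\<^sub>\<mu>(F, 1{\<sigma>(y) = t})\<bar>\<close> is at most \<open>K \<surd>\<delta>\<close>, where \<open>\<delta>\<close> is the average absolute pair
  correlation. Peeling off one random variable at a time turns this into approximate independence of
  all of them. The resulting error at \<open>x\<close> is at most \<open>c\<^sup>r \<surd>\<delta>\<close> if \<open>r\<close> constraints touch \<open>x\<close>, which is summable
  against the Poisson weights; Markov's inequality concludes.
\<close>

section \<open>Expectations under finitely supported distributions\<close>

abbreviation mean :: "'a pmf \<Rightarrow> ('a \<Rightarrow> real) \<Rightarrow> real" where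
  "mean p f \<equiv> measure_pmf.expectation p f"

declare integrable_measure_pmf_finite [simp]

lemma mean_eq_sum: "finite (set_pmf p) \<Longrightarrow> mean p f = (\<Sum>a\<in>set_pmf p. f a * pmf p a)"
  by (rule integral_measure_pmf_real) auto

lemma mean_cong: "(\<And>a. a \<in> set_pmf p \<Longrightarrow> f a = g a) \<Longrightarrow> mean p f = mean p g"
  by (intro integral_cong_AE) (auto simp: AE_measure_pmf_iff)

lemma mean_mono:
  assumes "finite (set_pmf p)" "\<And>a. a \<in> set_pmf p \<Longrightarrow> f a \<le> g a"
  shows "mean p f \<le> mean p g"
  using assms by (intro integral_mono_AE) (auto simp: AE_measure_pmf_iff)

lemma mean_nonneg: "(\<And>a. a \<in> set_pmf p \<Longrightarrow> 0 \<le> f a) \<Longrightarrow> 0 \<le> mean p f"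
  by (intro integral_nonneg_AE) (auto simp: AE_measure_pmf_iff)

lemma abs_mean_le_bound:
  assumes "finite (set_pmf p)" "\<And>a. a \<in> set_pmf p \<Longrightarrow> \<bar>f a\<bar> \<le> K"
  shows "\<bar>mean p f\<bar> \<le> K"
proof -
  have "- K \<le> f a \<and> f a \<le> K" if "a \<in> set_pmf p" for a
    using assms(2)[OF that] by (simp add: abs_le_iff)
  then show ?thesis
    using mean_mono[OF assms(1), of "\<lambda>_. - K" f] mean_mono[OF assms(1), of f "\<lambda>_. K"]
    by (simp add: abs_le_iff)
qed

lemma abs_bound_nonneg:
  fixes f :: "'a \<Rightarrow> real"
  assumes "\<And>a. a \<in> set_pmf p \<Longrightarrow> \<bar>f a\<bar> \<le> K"
  shows "0 \<le> K"
proof -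
  obtain a where "a \<in> set_pmf p" using set_pmf_not_empty by fast
  with assms show ?thesis by fastforce
qed

lemma mean_bind_pmf:
  assumes "finite (set_pmf p)" "\<And>a. a \<in> set_pmf p \<Longrightarrow> finite (set_pmf (q a))"
  shows "mean (bind_pmf p q) h = mean p (\<lambda>a. mean (q a) h)"
  using pmf_expectation_bind[of "set_pmf p" q p h] assms
  by (simp add: mean_eq_sum mult.commute)

lemma mean_pair_pmf:
  assumes "finite (set_pmf p)" "finite (set_pmf q)"
  shows "mean (pair_pmf p q) h = mean p (\<lambda>a. mean q (\<lambda>b. h (a, b)))"
  unfolding pair_pmf_def using assms by (simp add: mean_bind_pmf)

lemma mean_swap:
  assumes "finite (set_pmf p)" "finite (set_pmf q)"
  shows "mean p (\<lambda>a. mean q (\<lambda>b. f a b)) = mean q (\<lambda>b. mean p (\<lambda>a. f a b))"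
  using mean_pair_pmf[OF assms, of "case_prod f"] mean_pair_pmf[OF assms(2,1), of "\<lambda>(b, a). f a b"]
  by (subst (asm) pair_commute_pmf) (simp add: case_prod_unfold)

lemma mean_le_sqrt_mean_square:
  assumes "integrable (measure_pmf p) (\<lambda>a. (f a)\<^sup>2)"
  shows "mean p f \<le> sqrt (mean p (\<lambda>a. (f a)\<^sup>2))"
proof (rule real_le_rsqrt)
  have "integrable (measure_pmf p) f"
    using assms by (rule measure_pmf.square_integrable_imp_integrable[rotated]) simp
  then have "measure_pmf.variance p f = mean p (\<lambda>a. (f a)\<^sup>2) - (mean p f)\<^sup>2"
    using assms by (rule measure_pmf.variance_eq)
  then show "(mean p f)\<^sup>2 \<le> mean p (\<lambda>a. (f a)\<^sup>2)"
    using measure_pmf.variance_positive[of p f] by simp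
qed

lemma pmf_map_eq_mean: "pmf (map_pmf h \<mu>) t = mean \<mu> (\<lambda>\<sigma>. of_bool (h \<sigma> = t))"
proof -
  have "pmf (map_pmf h \<mu>) t = mean \<mu> (indicator {\<sigma>. h \<sigma> = t})" by (simp add: pmf_map vimage_def)
  also have "indicator {\<sigma>. h \<sigma> = t} = (\<lambda>\<sigma>. of_bool (h \<sigma> = t) :: real)" by (auto simp: fun_eq_iff)
  finally show ?thesis .
qed

lemma nn_integral_eq_mean:
  assumes "finite (set_pmf p)" "\<And>a. a \<in> set_pmf p \<Longrightarrow> 0 \<le> f a"
  shows "(\<integral>\<^sup>+a. ennreal (f a) \<partial>p) = ennreal (mean p f)"
  using assms by (intro nn_integral_eq_integral) (auto simp: AE_measure_pmf_iff)

lemma nn_integral_pmf_swap: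
  "(\<integral>\<^sup>+a. \<integral>\<^sup>+b. f a b \<partial>measure_pmf q \<partial>measure_pmf p) = (\<integral>\<^sup>+b. \<integral>\<^sup>+a. f a b \<partial>measure_pmf p \<partial>measure_pmf q)"
proof -
  have "(\<integral>\<^sup>+a. \<integral>\<^sup>+b. f a b \<partial>measure_pmf q \<partial>measure_pmf p) = (\<integral>\<^sup>+z. case_prod f z \<partial>pair_pmf p q)"
    by (simp add: nn_integral_pair_pmf')
  also have "\<dots> = (\<integral>\<^sup>+b. \<integral>\<^sup>+a. f a b \<partial>measure_pmf p \<partial>measure_pmf q)"
    by (subst pair_commute_pmf) (simp add: nn_integral_pair_pmf')
  finally show ?thesis .
qed

lemma finite_set_replicate_pmf [simp]: "finite (set_pmf p) \<Longrightarrow> finite (set_pmf (replicate_pmf r p))"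
  using finite_lists_length_eq[of "set_pmf p" r] by (simp add: set_replicate_pmf lists_eq_set)

lemma in_set_replicate_pmf: "c \<in> set_pmf (replicate_pmf r p) \<longleftrightarrow> length c = r \<and> set c \<subseteq> set_pmf p"
  by (auto simp: set_replicate_pmf lists_eq_set)

lemma mean_replicate_pmf_Suc:
  assumes "finite (set_pmf p)"
  shows "mean (replicate_pmf (Suc r) p) h = mean p (\<lambda>b. mean (replicate_pmf r p) (\<lambda>c. h (b # c)))"
  using assms by (simp add: mean_bind_pmf)

lemma mean_replicate_pmf_sum_list:
  assumes "finite (set_pmf p)"
  shows "mean (replicate_pmf r p) (\<lambda>c. \<Sum>b\<leftarrow>c. e b) = r * mean p e"
proof (induction r)
  case (Suc r)
  then show ?case
    using assms by (simp only: mean_replicate_pmf_Suc) (simp add: algebra_simps)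
qed simp

section \<open>Integration against an intensity measure\<close>

text \<open>In a Poisson sample of rate \<open>l\<close> from \<open>p\<close>, the points satisfying \<open>Q\<close> have intensity measure \<open>l \<cdot> p\<close>
  restricted to \<open>Q\<close>; the list version integrates against its \<open>r\<close>-th power.\<close>

definition intensity_integral :: "real \<Rightarrow> 'a pmf \<Rightarrow> ('a \<Rightarrow> bool) \<Rightarrow> ('a \<Rightarrow> real) \<Rightarrow> real" where
  "intensity_integral l p Q h = l * mean p (\<lambda>b. of_bool (Q b) * h b)"

abbreviation intensity_integral_list :: "real \<Rightarrow> 'a pmf \<Rightarrow> ('a \<Rightarrow> bool) \<Rightarrow> nat \<Rightarrow> ('a list \<Rightarrow> real) \<Rightarrow> real" where
  "intensity_integral_list l p Q r \<equiv> intensity_integral (l ^ r) (replicate_pmf r p) (\<lambda>c. \<forall>b\<in>set c. Q b)"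

lemma intensity_integral_mono:
  assumes "0 \<le> l" "finite (set_pmf p)" "\<And>b. b \<in> set_pmf p \<Longrightarrow> Q b \<Longrightarrow> f b \<le> g b"
  shows "intensity_integral l p Q f \<le> intensity_integral l p Q g"
proof -
  have "of_bool (Q b) * f b \<le> of_bool (Q b) * g b" if "b \<in> set_pmf p" for b
    using assms(3)[OF that] by (cases "Q b") auto
  then show ?thesis
    unfolding intensity_integral_def using assms(1,2) by (intro mult_left_mono[OF mean_mono])
qed

lemma intensity_integral_nonneg:
  assumes "0 \<le> l" "\<And>b. b \<in> set_pmf p \<Longrightarrow> Q b \<Longrightarrow> 0 \<le> f b"
  shows "0 \<le> intensity_integral l p Q f"
proof -
  have "0 \<le> of_bool (Q b) * f b" if "b \<in> set_pmf p" for b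
    using assms(2)[OF that] by (cases "Q b") auto
  then show ?thesis
    unfolding intensity_integral_def using assms(1) by (intro mult_nonneg_nonneg[OF _ mean_nonneg])
qed

lemma intensity_integral_add:
  assumes "finite (set_pmf p)"
  shows "intensity_integral l p Q (\<lambda>b. f b + g b) = intensity_integral l p Q f + intensity_integral l p Q g"
  unfolding intensity_integral_def using assms by (simp add: distrib_left)

lemma intensity_integral_cmult: "intensity_integral l p Q (\<lambda>b. c * f b) = c * intensity_integral l p Q f"
  unfolding intensity_integral_def by (simp only: mult.left_commute[of _ c] integral_mult_right_zero)

lemma intensity_integral_sum:
  assumes "finite (set_pmf p)"
  shows "intensity_integral l p Q (\<lambda>b. \<Sum>i\<in>I. f i b) = (\<Sum>i\<in>I. intensity_integral l p Q (f i))"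
  unfolding intensity_integral_def using assms by (simp add: sum_distrib_left)

lemma intensity_integral_const: "intensity_integral l p Q (\<lambda>_. c) = c * intensity_integral l p Q (\<lambda>_. 1)"
  using intensity_integral_cmult[of l p Q c "\<lambda>_. 1"] by simp

lemma nn_integral_intensity_integral:
  assumes "0 \<le> l" "finite (set_pmf p)" "\<And>b. 0 \<le> h b"
  shows "ennreal l * (\<integral>\<^sup>+b. of_bool (Q b) * ennreal (h b) \<partial>p) = ennreal (intensity_integral l p Q h)"
proof -
  have "(\<integral>\<^sup>+b. of_bool (Q b) * ennreal (h b) \<partial>p) = (\<integral>\<^sup>+b. ennreal (of_bool (Q b) * h b) \<partial>p)"
    by (intro nn_integral_cong) simp
  also have "\<dots> = ennreal (mean p (\<lambda>b. of_bool (Q b) * h b))"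
    using assms by (intro nn_integral_eq_mean) auto
  finally show ?thesis using assms(1) by (simp add: intensity_integral_def ennreal_mult'[symmetric])
qed

lemma intensity_integral_list_Suc:
  assumes "finite (set_pmf p)"
  shows "intensity_integral_list l p Q (Suc r) h
       = intensity_integral l p Q (\<lambda>b. intensity_integral_list l p Q r (\<lambda>c. h (b # c)))"
  unfolding intensity_integral_def mean_replicate_pmf_Suc[OF assms]
  by (simp add: of_bool_conj mult_ac)

lemma intensity_integral_list_one_le:
  assumes "finite (set_pmf p)" "0 \<le> l" "intensity_integral l p Q (\<lambda>_. 1) \<le> d"
  shows "intensity_integral_list l p Q r (\<lambda>_. 1) \<le> d ^ r"
proof (induction r)
  case (Suc r)
  have "intensity_integral_list l p Q (Suc r) (\<lambda>_. 1)
      = intensity_integral_list l p Q r (\<lambda>_. 1) * intensity_integral l p Q (\<lambda>_. 1)"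
    unfolding intensity_integral_list_Suc[OF assms(1)] by (rule intensity_integral_const)
  also have "\<dots> \<le> d ^ r * d"
    using Suc assms(2,3) order_trans[OF intensity_integral_nonneg assms(3)]
    by (intro mult_mono intensity_integral_nonneg) auto
  finally show ?case by (simp add: mult.commute)
qed (simp add: intensity_integral_def)

section \<open>The Mecke formula and Poisson thinning\<close>

definition delete_nth :: "nat \<Rightarrow> 'a list \<Rightarrow> 'a list" where
  "delete_nth i xs = take i xs @ drop (Suc i) xs"

lemma mset_nth_delete_nth: "i < length xs \<Longrightarrow> mset (xs ! i # delete_nth i xs) = mset xs"
  by (subst (3) id_take_nth_drop[of i xs]) (simp_all add: delete_nth_def)

lemma map_pmf_nth_delete_nth_replicate_pmf:
  assumes "i \<le> r"
  shows "map_pmf (\<lambda>c. (c ! i, delete_nth i c)) (replicate_pmf (Suc r) p) = pair_pmf p (replicate_pmf r p)"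
proof -
  have len: "length xs = i" if "xs \<in> set_pmf (replicate_pmf i p)" for xs
    using that by (simp add: in_set_replicate_pmf)
  have "replicate_pmf (Suc r) p = replicate_pmf (i + Suc (r - i)) p" using assms by simp
  then have "map_pmf (\<lambda>c. (c ! i, delete_nth i c)) (replicate_pmf (Suc r) p)
      = do {xs \<leftarrow> replicate_pmf i p; b \<leftarrow> p; ys \<leftarrow> replicate_pmf (r - i) p; return_pmf (b, xs @ ys)}"
    unfolding replicate_pmf_distrib
    by (simp add: map_bind_pmf bind_assoc_pmf bind_return_pmf)
      (intro bind_pmf_cong refl, simp add: len delete_nth_def nth_append)
  also have "\<dots> = do {b \<leftarrow> p; xs \<leftarrow> replicate_pmf i p; ys \<leftarrow> replicate_pmf (r - i) p; return_pmf (b, xs @ ys)}"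
    by (rule bind_commute_pmf)
  also have "\<dots> = pair_pmf p (replicate_pmf (i + (r - i)) p)"
    unfolding pair_pmf_def replicate_pmf_distrib by (simp add: bind_assoc_pmf bind_return_pmf)
  finally show ?thesis using assms by simp
qed

lemma mean_nth_delete_nth_replicate_pmf:
  assumes "finite (set_pmf p)" "i \<le> r"
  shows "mean (replicate_pmf (Suc r) p) (\<lambda>c. h (c ! i) (delete_nth i c))
       = mean p (\<lambda>b. mean (replicate_pmf r p) (h b))"
proof -
  have "mean (replicate_pmf (Suc r) p) (\<lambda>c. h (c ! i) (delete_nth i c))
      = mean (map_pmf (\<lambda>c. (c ! i, delete_nth i c)) (replicate_pmf (Suc r) p)) (case_prod h)"
    by simp
  then show ?thesis
    unfolding map_pmf_nth_delete_nth_replicate_pmf[OF assms(2)] using assms(1) by (simp add: mean_pair_pmf)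
qed

lemma nn_integral_nth_delete_nth_replicate_pmf:
  assumes "i \<le> r"
  shows "(\<integral>\<^sup>+c. h (c ! i) (delete_nth i c) \<partial>replicate_pmf (Suc r) p)
       = (\<integral>\<^sup>+b. \<integral>\<^sup>+c. h b c \<partial>replicate_pmf r p \<partial>p)"
proof -
  have "(\<integral>\<^sup>+c. h (c ! i) (delete_nth i c) \<partial>replicate_pmf (Suc r) p)
      = (\<integral>\<^sup>+z. case_prod h z \<partial>map_pmf (\<lambda>c. (c ! i, delete_nth i c)) (replicate_pmf (Suc r) p))"
    by (simp only: nn_integral_map_pmf prod.case)
  then show ?thesis
    unfolding map_pmf_nth_delete_nth_replicate_pmf[OF assms] by (simp only: nn_integral_pair_pmf' prod.case)
qed

definition poisson_list_pmf :: "real \<Rightarrow> 'a pmf \<Rightarrow> 'a list pmf" where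
  "poisson_list_pmf l p = bind_pmf (poisson_pmf l) (\<lambda>m. replicate_pmf m p)"

lemma set_poisson_list_pmf: "c \<in> set_pmf (poisson_list_pmf l p) \<Longrightarrow> set c \<subseteq> set_pmf p"
  unfolding poisson_list_pmf_def by (auto simp: in_set_replicate_pmf)

lemma nn_integral_poisson_list_pmf:
  assumes "0 < l"
  shows "(\<integral>\<^sup>+c. F c \<partial>poisson_list_pmf l p)
       = (\<Sum>m. ennreal (l ^ m / fact m * exp (- l)) * (\<integral>\<^sup>+c. F c \<partial>replicate_pmf m p))"
  unfolding poisson_list_pmf_def nn_integral_bind_pmf nn_integral_measure_pmf[of "poisson_pmf l"]
    nn_integral_count_space_nat
  using assms by simp

theorem mecke_poisson_list_pmf:
  assumes "0 < l"
  shows "(\<integral>\<^sup>+c. (\<Sum>i<length c. h (c ! i) (delete_nth i c)) \<partial>poisson_list_pmf l p)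
       = ennreal l * (\<integral>\<^sup>+b. \<integral>\<^sup>+c. h b c \<partial>poisson_list_pmf l p \<partial>p)"
proof -
  let ?w = "\<lambda>m. l ^ m / fact m * exp (- l)"
  have level: "(\<integral>\<^sup>+c. (\<Sum>i<length c. h (c ! i) (delete_nth i c)) \<partial>replicate_pmf m p)
      = (\<Sum>i<m. \<integral>\<^sup>+c. h (c ! i) (delete_nth i c) \<partial>replicate_pmf m p)" for m
  proof -
    have "(\<integral>\<^sup>+c. (\<Sum>i<length c. h (c ! i) (delete_nth i c)) \<partial>replicate_pmf m p)
        = (\<integral>\<^sup>+c. (\<Sum>i<m. h (c ! i) (delete_nth i c)) \<partial>replicate_pmf m p)"
      by (intro nn_integral_cong_AE) (simp add: AE_measure_pmf_iff in_set_replicate_pmf)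
    then show ?thesis by (simp add: nn_integral_sum)
  qed
  have weight: "ennreal (?w (Suc m)) * of_nat (Suc m) = ennreal l * ennreal (?w m)" for m
    using assms
    by (simp add: ennreal_of_nat_eq_real_of_nat ennreal_mult'[symmetric] field_simps del: of_nat_Suc)
  have "(\<integral>\<^sup>+c. (\<Sum>i<length c. h (c ! i) (delete_nth i c)) \<partial>poisson_list_pmf l p)
      = (\<Sum>m. ennreal (?w (Suc m)) * (of_nat (Suc m) * (\<integral>\<^sup>+b. \<integral>\<^sup>+c. h b c \<partial>replicate_pmf m p \<partial>p)))"
    unfolding nn_integral_poisson_list_pmf[OF assms] level
    by (subst suminf_offset[where i = 1])
      (simp_all add: nn_integral_nth_delete_nth_replicate_pmf
        del: replicate_pmf.simps sum.lessThan_Suc of_nat_Suc fact_Suc power_Suc)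
  also have "\<dots> = (\<Sum>m. ennreal l * (ennreal (?w m) * (\<integral>\<^sup>+b. \<integral>\<^sup>+c. h b c \<partial>replicate_pmf m p \<partial>p)))"
    by (simp only: mult.assoc[symmetric] weight)
  also have "\<dots> = ennreal l * (\<Sum>m. ennreal (?w m) * (\<integral>\<^sup>+b. \<integral>\<^sup>+c. h b c \<partial>replicate_pmf m p \<partial>p))"
    by (rule ennreal_suminf_cmult)
  also have "(\<Sum>m. ennreal (?w m) * (\<integral>\<^sup>+b. \<integral>\<^sup>+c. h b c \<partial>replicate_pmf m p \<partial>p))
      = (\<integral>\<^sup>+b. \<integral>\<^sup>+c. h b c \<partial>poisson_list_pmf l p \<partial>p)"
    unfolding nn_integral_poisson_list_pmf[OF assms]
    by (simp add: nn_integral_suminf nn_integral_cmult)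
  finally show ?thesis .
qed

lemma nn_integral_poisson_sum_intensity_integral:
  fixes h :: "'a \<Rightarrow> 'a list \<Rightarrow> real"
  assumes l: "0 < l" and p: "finite (set_pmf p)" and h: "\<And>b c. 0 \<le> h b c"
  shows "(\<integral>\<^sup>+c. ennreal (\<Sum>i | i < length c \<and> Q (c ! i). h (c ! i) (delete_nth i c)) \<partial>poisson_list_pmf l p)
       = (\<integral>\<^sup>+c. ennreal (intensity_integral l p Q (\<lambda>b. h b c)) \<partial>poisson_list_pmf l p)"
proof -
  let ?M = "poisson_list_pmf l p"
  let ?h = "\<lambda>b c. of_bool (Q b) * ennreal (h b c)"
  have sum: "ennreal (\<Sum>i | i < length c \<and> Q (c ! i). h (c ! i) (delete_nth i c))
      = (\<Sum>i<length c. ?h (c ! i) (delete_nth i c))" for c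
  proof -
    have "ennreal (\<Sum>i | i < length c \<and> Q (c ! i). h (c ! i) (delete_nth i c))
        = (\<Sum>i | i < length c \<and> Q (c ! i). ennreal (h (c ! i) (delete_nth i c)))"
      using h by (simp add: sum_ennreal)
    also have "\<dots> = (\<Sum>i<length c. ?h (c ! i) (delete_nth i c))"
      by (intro sum.mono_neutral_cong_left) auto
    finally show ?thesis .
  qed
  have "(\<integral>\<^sup>+c. (\<Sum>i<length c. ?h (c ! i) (delete_nth i c)) \<partial>?M) = ennreal l * (\<integral>\<^sup>+b. \<integral>\<^sup>+c. ?h b c \<partial>?M \<partial>p)"
    by (rule mecke_poisson_list_pmf[OF l])
  also have "\<dots> = (\<integral>\<^sup>+c. ennreal l * (\<integral>\<^sup>+b. ?h b c \<partial>p) \<partial>?M)"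
    by (subst nn_integral_pmf_swap) (simp add: nn_integral_cmult)
  also have "\<dots> = (\<integral>\<^sup>+c. ennreal (intensity_integral l p Q (\<lambda>b. h b c)) \<partial>?M)"
    using l p h by (simp only: nn_integral_intensity_integral less_imp_le)
  finally show ?thesis by (simp only: sum)
qed

lemma sum_delete_nth_filter:
  fixes f :: "'a list \<Rightarrow> ennreal"
  assumes perm: "\<And>c c'. mset c = mset c' \<Longrightarrow> f c = f c'"
  shows "(\<Sum>i<length c. of_bool (Q (c ! i)) *
            (of_bool (length (filter Q (delete_nth i c)) = r) * f (c ! i # delete_nth i c)))
       = of_nat (Suc r) * (of_bool (length (filter Q c) = Suc r) * f c)"
proof -
  have "of_bool (Q (c ! i)) * (of_bool (length (filter Q (delete_nth i c)) = r) * f (c ! i # delete_nth i c))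
      = (if Q (c ! i) then of_bool (length (filter Q c) = Suc r) * f c else 0)" if "i < length c" for i
  proof -
    have "length (filter Q c) = length (filter Q (c ! i # delete_nth i c))"
      using mset_nth_delete_nth[OF that] by (metis mset_filter size_mset)
    then show ?thesis using perm[OF mset_nth_delete_nth[OF that]] by auto
  qed
  then have "(\<Sum>i<length c. of_bool (Q (c ! i)) *
        (of_bool (length (filter Q (delete_nth i c)) = r) * f (c ! i # delete_nth i c)))
      = (\<Sum>i<length c. if Q (c ! i) then of_bool (length (filter Q c) = Suc r) * f c else 0)"
    by (intro sum.cong) (simp_all only: lessThan_iff)
  also have "\<dots> = of_nat (card {i. i < length c \<and> Q (c ! i)}) * (of_bool (length (filter Q c) = Suc r) * f c)"
    by (simp add: sum.If_cases Int_def)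
  finally show ?thesis by (simp add: length_filter_conv_card[symmetric] del: of_nat_Suc)
qed

lemma nn_integral_poisson_list_pmf_filter:
  fixes f :: "'a list \<Rightarrow> ennreal"
  assumes l: "0 < l" and perm: "\<And>c c'. mset c = mset c' \<Longrightarrow> f c = f c'"
  shows "of_nat (fact r) * (\<integral>\<^sup>+c. of_bool (length (filter Q c) = r) * f c \<partial>poisson_list_pmf l p)
       = ennreal l ^ r * (\<integral>\<^sup>+b. of_bool (\<forall>a\<in>set b. Q a) *
           (\<integral>\<^sup>+c. of_bool (\<forall>a\<in>set c. \<not> Q a) * f (b @ c) \<partial>poisson_list_pmf l p) \<partial>replicate_pmf r p)"
  using perm
proof (induction r arbitrary: f)
  case 0
  show ?case by (simp add: filter_empty_conv)
next
  case (Suc r)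
  let ?M = "poisson_list_pmf l p"
  have delete: "of_nat (Suc r) * (of_bool (length (filter Q c) = Suc r) * f c)
      = (\<Sum>i<length c. of_bool (Q (c ! i)) *
          (of_bool (length (filter Q (delete_nth i c)) = r) * f (c ! i # delete_nth i c)))" for c
    by (rule sum_delete_nth_filter[symmetric]) (rule Suc.prems)
  have "of_nat (fact (Suc r)) * (\<integral>\<^sup>+c. of_bool (length (filter Q c) = Suc r) * f c \<partial>?M)
      = of_nat (fact r) * (\<integral>\<^sup>+c. of_nat (Suc r) * (of_bool (length (filter Q c) = Suc r) * f c) \<partial>?M)"
    by (subst nn_integral_cmult) (simp_all only: fact_Suc of_nat_mult of_nat_id mult_ac, simp)
  also have "\<dots> = of_nat (fact r) * (ennreal l * (\<integral>\<^sup>+b. \<integral>\<^sup>+c. of_bool (Q b) *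
      (of_bool (length (filter Q c) = r) * f (b # c)) \<partial>?M \<partial>p))"
    unfolding mecke_poisson_list_pmf[OF l, symmetric] delete ..
  also have "\<dots> = ennreal l * (\<integral>\<^sup>+b. of_bool (Q b) *
      (of_nat (fact r) * (\<integral>\<^sup>+c. of_bool (length (filter Q c) = r) * f (b # c) \<partial>?M)) \<partial>p)"
    by (simp add: nn_integral_cmult[symmetric] mult_ac)
  also have "\<dots> = ennreal l * (\<integral>\<^sup>+b. of_bool (Q b) * (ennreal l ^ r * (\<integral>\<^sup>+b'. of_bool (\<forall>a\<in>set b'. Q a) *
      (\<integral>\<^sup>+c. of_bool (\<forall>a\<in>set c. \<not> Q a) * f (b # b' @ c) \<partial>?M) \<partial>replicate_pmf r p)) \<partial>p)"
    by (subst Suc.IH) (auto intro!: Suc.prems)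
  also have "\<dots> = ennreal l ^ Suc r * (\<integral>\<^sup>+b. of_bool (\<forall>a\<in>set b. Q a) *
      (\<integral>\<^sup>+c. of_bool (\<forall>a\<in>set c. \<not> Q a) * f (b @ c) \<partial>?M) \<partial>replicate_pmf (Suc r) p)"
    by (simp add: nn_integral_cmult[symmetric] of_bool_conj mult_ac)
  finally show ?case .
qed

lemma nn_integral_poisson_list_pmf_filter_le:
  fixes f \<Delta> :: "'a list \<Rightarrow> real"
  assumes l: "0 < l" and p: "finite (set_pmf p)"
    and perm: "\<And>c c'. mset c = mset c' \<Longrightarrow> f c = f c'"
    and f: "\<And>c. 0 \<le> f c" and \<Delta>: "\<And>c. 0 \<le> \<Delta> c" and a: "0 \<le> a"
    and le: "\<And>c. set c \<subseteq> set_pmf p \<Longrightarrow> \<forall>a\<in>set c. \<not> Q a \<Longrightarrow>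
        intensity_integral_list l p Q r (\<lambda>b. f (b @ c)) \<le> a * \<Delta> c"
  shows "(\<integral>\<^sup>+c. of_bool (length (filter Q c) = r) * ennreal (f c) \<partial>poisson_list_pmf l p)
       \<le> ennreal (a / fact r) * (\<integral>\<^sup>+c. ennreal (\<Delta> c) \<partial>poisson_list_pmf l p)"
proof -
  let ?M = "poisson_list_pmf l p"
  let ?I = "\<lambda>c. intensity_integral_list l p Q r (\<lambda>b. f (b @ c))"
  have "of_nat (fact r) * (\<integral>\<^sup>+c. of_bool (length (filter Q c) = r) * ennreal (f c) \<partial>?M)
      = ennreal l ^ r * (\<integral>\<^sup>+b. \<integral>\<^sup>+c. of_bool (\<forall>a\<in>set c. \<not> Q a) *
          (of_bool (\<forall>a\<in>set b. Q a) * ennreal (f (b @ c))) \<partial>?M \<partial>replicate_pmf r p)"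
    by (subst nn_integral_poisson_list_pmf_filter[OF l])
      (auto simp: nn_integral_cmult[symmetric] mult.left_commute intro!: arg_cong[of _ _ ennreal] perm)
  also have "\<dots> = ennreal l ^ r * (\<integral>\<^sup>+c. \<integral>\<^sup>+b. of_bool (\<forall>a\<in>set c. \<not> Q a) *
          (of_bool (\<forall>a\<in>set b. Q a) * ennreal (f (b @ c))) \<partial>replicate_pmf r p \<partial>?M)"
    by (subst nn_integral_pmf_swap) (rule refl)
  also have "\<dots> = (\<integral>\<^sup>+c. of_bool (\<forall>a\<in>set c. \<not> Q a) * (ennreal (l ^ r) *
          (\<integral>\<^sup>+b. of_bool (\<forall>a\<in>set b. Q a) * ennreal (f (b @ c)) \<partial>replicate_pmf r p)) \<partial>?M)"
    using l by (simp add: nn_integral_cmult[symmetric] ennreal_power mult.left_commute)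
  also have "\<dots> = (\<integral>\<^sup>+c. of_bool (\<forall>a\<in>set c. \<not> Q a) * ennreal (?I c) \<partial>?M)"
    using l p f by (subst nn_integral_intensity_integral) auto
  also have "\<dots> \<le> (\<integral>\<^sup>+c. ennreal a * ennreal (\<Delta> c) \<partial>?M)"
    using le a \<Delta> set_poisson_list_pmf[of _ l p]
    by (intro nn_integral_mono_AE) (auto simp: AE_measure_pmf_iff ennreal_mult[symmetric] intro!: ennreal_leI)
  also have "\<dots> = of_nat (fact r) * (ennreal (a / fact r) * (\<integral>\<^sup>+c. ennreal (\<Delta> c) \<partial>?M))"
  proof -
    have "ennreal a = of_nat (fact r) * ennreal (a / fact r)"
      using a by (simp add: ennreal_of_nat_eq_real_of_nat ennreal_mult'[symmetric])
    then show ?thesis by (simp add: nn_integral_cmult mult.assoc)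
  qed
  finally show ?thesis
    by (simp add: ennreal_mult_le_mult_iff ennreal_of_nat_eq_real_of_nat)
qed

text \<open>On the right \<open>\<Delta>\<close> is averaged over the whole Poisson sample rather than over its part outside \<open>Q\<close>: a sample
  of that part is a sample of the whole on the event that nothing satisfies \<open>Q\<close>.\<close>

theorem nn_integral_poisson_list_pmf_le:
  fixes f \<Delta> :: "'a list \<Rightarrow> real"
  assumes l: "0 < l" and p: "finite (set_pmf p)"
    and perm: "\<And>c c'. mset c = mset c' \<Longrightarrow> f c = f c'"
    and f: "\<And>c. 0 \<le> f c" and \<Delta>: "\<And>c. 0 \<le> \<Delta> c"
    and le: "\<And>r c. set c \<subseteq> set_pmf p \<Longrightarrow> \<forall>a\<in>set c. \<not> Q a \<Longrightarrow>
        intensity_integral_list l p Q r (\<lambda>b. f (b @ c)) \<le> a r * \<Delta> c"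
    and a: "\<And>r. 0 \<le> a r" "(\<lambda>r. a r / fact r) sums K"
  shows "(\<integral>\<^sup>+c. ennreal (f c) \<partial>poisson_list_pmf l p) \<le> ennreal K * (\<integral>\<^sup>+c. ennreal (\<Delta> c) \<partial>poisson_list_pmf l p)"
proof -
  let ?M = "poisson_list_pmf l p"
  let ?level = "\<lambda>r. \<integral>\<^sup>+c. of_bool (length (filter Q c) = r) * ennreal (f c) \<partial>?M"
  have level: "?level r \<le> ennreal (a r / fact r) * (\<integral>\<^sup>+c. ennreal (\<Delta> c) \<partial>?M)" for r
    using l p perm f \<Delta> a(1) le by (rule nn_integral_poisson_list_pmf_filter_le)
  have "(\<integral>\<^sup>+c. ennreal (f c) \<partial>?M) = (\<integral>\<^sup>+c. (\<Sum>r. of_bool (length (filter Q c) = r) * ennreal (f c)) \<partial>?M)"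
  proof (intro nn_integral_cong)
    fix c
    show "ennreal (f c) = (\<Sum>r. of_bool (length (filter Q c) = r) * ennreal (f c))"
      by (subst suminf_finite[of "{length (filter Q c)}"]) auto
  qed
  also have "\<dots> = (\<Sum>r. ?level r)" by (rule nn_integral_suminf) simp
  also have "\<dots> \<le> (\<Sum>r. ennreal (a r / fact r) * (\<integral>\<^sup>+c. ennreal (\<Delta> c) \<partial>?M))"
    by (intro suminf_le level summableI)
  also have "\<dots> = ennreal K * (\<integral>\<^sup>+c. ennreal (\<Delta> c) \<partial>?M)"
    unfolding ennreal_suminf_multc using a by (subst suminf_ennreal_eq) auto
  finally show ?thesis .
qed

section \<open>Covariances and Bessel's inequality\<close>

definition cov :: "'a pmf \<Rightarrow> ('a \<Rightarrow> real) \<Rightarrow> ('a \<Rightarrow> real) \<Rightarrow> real" where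
  "cov \<mu> f g = mean \<mu> (\<lambda>\<sigma>. f \<sigma> * g \<sigma>) - mean \<mu> f * mean \<mu> g"

lemma cov_eq_mean_centered_right:
  assumes "finite (set_pmf \<mu>)"
  shows "cov \<mu> f g = mean \<mu> (\<lambda>\<sigma>. f \<sigma> * (g \<sigma> - mean \<mu> g))"
  using assms by (simp add: cov_def right_diff_distrib)

lemma cov_eq_mean_centered:
  assumes "finite (set_pmf \<mu>)"
  shows "cov \<mu> f g = mean \<mu> (\<lambda>\<sigma>. (f \<sigma> - mean \<mu> f) * (g \<sigma> - mean \<mu> g))"
  using assms by (simp add: cov_def algebra_simps)

lemma cov_commute: "cov \<mu> f g = cov \<mu> g f"
  by (simp add: cov_def mult.commute)

lemma cov_const_right:
  assumes "\<And>\<sigma>. \<sigma> \<in> set_pmf \<mu> \<Longrightarrow> g \<sigma> = c"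
  shows "cov \<mu> f g = 0"
proof -
  have "mean \<mu> g = c" using mean_cong[of \<mu> g "\<lambda>_. c"] assms by simp
  moreover have "mean \<mu> (\<lambda>\<sigma>. f \<sigma> * g \<sigma>) = mean \<mu> (\<lambda>\<sigma>. f \<sigma> * c)" using assms by (intro mean_cong) simp
  ultimately show ?thesis by (simp add: cov_def)
qed

lemma mean_square_centered_average_le:
  fixes X :: "'i \<Rightarrow> 'a \<Rightarrow> real" and a :: "'i \<Rightarrow> real"
  assumes \<mu>: "finite (set_pmf \<mu>)" and U: "finite (set_pmf U)" and a: "\<And>y. \<bar>a y\<bar> \<le> 1"
  shows "mean \<mu> (\<lambda>\<sigma>. (mean U (\<lambda>y. a y * (X y \<sigma> - mean \<mu> (X y))))\<^sup>2)
       \<le> mean U (\<lambda>i. mean U (\<lambda>j. \<bar>cov \<mu> (X i) (X j)\<bar>))"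
proof -
  define Y where "Y y \<sigma> = X y \<sigma> - mean \<mu> (X y)" for y \<sigma>
  have "mean \<mu> (\<lambda>\<sigma>. (mean U (\<lambda>y. a y * Y y \<sigma>))\<^sup>2)
      = mean \<mu> (\<lambda>\<sigma>. mean U (\<lambda>i. mean U (\<lambda>j. a i * a j * (Y i \<sigma> * Y j \<sigma>))))"
    by (simp add: power2_eq_square mult_ac flip: integral_mult_right_zero integral_mult_left_zero)
  also have "\<dots> = mean U (\<lambda>i. mean U (\<lambda>j. mean \<mu> (\<lambda>\<sigma>. a i * a j * (Y i \<sigma> * Y j \<sigma>))))"
    unfolding mean_swap[OF \<mu> U] ..
  also have "\<dots> = mean U (\<lambda>i. mean U (\<lambda>j. a i * a j * cov \<mu> (X i) (X j)))"
    by (simp add: cov_eq_mean_centered[OF \<mu>] Y_def)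
  also have "\<dots> \<le> mean U (\<lambda>i. mean U (\<lambda>j. \<bar>cov \<mu> (X i) (X j)\<bar>))"
  proof (intro mean_mono U)
    fix i j
    have "\<bar>a i\<bar> * \<bar>a j\<bar> * \<bar>cov \<mu> (X i) (X j)\<bar> \<le> 1 * \<bar>cov \<mu> (X i) (X j)\<bar>"
      using a by (intro mult_right_mono mult_le_one) auto
    then show "a i * a j * cov \<mu> (X i) (X j) \<le> \<bar>cov \<mu> (X i) (X j)\<bar>"
      unfolding abs_mult[symmetric] by linarith
  qed
  finally show ?thesis unfolding Y_def .
qed

text \<open>Test \<open>F\<close> against the average \<open>S\<close> of the centred \<open>X\<^sub>y\<close>,
  with the signs of the covariances as coefficients.\<close>

theorem bessel_inequality:
  fixes X :: "'i \<Rightarrow> 'a \<Rightarrow> real"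
  assumes \<mu>: "finite (set_pmf \<mu>)" and U: "finite (set_pmf U)"
    and F: "\<And>\<sigma>. \<sigma> \<in> set_pmf \<mu> \<Longrightarrow> \<bar>F \<sigma>\<bar> \<le> K"
  shows "mean U (\<lambda>y. \<bar>cov \<mu> F (X y)\<bar>) \<le> K * sqrt (mean U (\<lambda>i. mean U (\<lambda>j. \<bar>cov \<mu> (X i) (X j)\<bar>)))"
proof -
  let ?a = "\<lambda>y. sgn (cov \<mu> F (X y))"
  let ?Y = "\<lambda>y \<sigma>. X y \<sigma> - mean \<mu> (X y)"
  let ?S = "\<lambda>\<sigma>. mean U (\<lambda>y. ?a y * ?Y y \<sigma>)"
  have K: "0 \<le> K" using F by (rule abs_bound_nonneg)
  have "mean U (\<lambda>y. \<bar>cov \<mu> F (X y)\<bar>) = mean U (\<lambda>y. ?a y * mean \<mu> (\<lambda>\<sigma>. F \<sigma> * ?Y y \<sigma>))"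
    by (simp add: cov_eq_mean_centered_right[OF \<mu>, symmetric] abs_sgn mult.commute)
  also have "\<dots> = mean U (\<lambda>y. mean \<mu> (\<lambda>\<sigma>. F \<sigma> * (?a y * ?Y y \<sigma>)))"
    by (simp add: mult.left_commute[of "F _"])
  also have "\<dots> = mean \<mu> (\<lambda>\<sigma>. F \<sigma> * ?S \<sigma>)"
    by (subst mean_swap[OF U \<mu>]) simp
  also have "\<dots> \<le> mean \<mu> (\<lambda>\<sigma>. K * \<bar>?S \<sigma>\<bar>)"
  proof (rule mean_mono[OF \<mu>])
    fix \<sigma> assume "\<sigma> \<in> set_pmf \<mu>"
    then have "\<bar>F \<sigma>\<bar> * \<bar>?S \<sigma>\<bar> \<le> K * \<bar>?S \<sigma>\<bar>" by (intro mult_right_mono F) auto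
    then show "F \<sigma> * ?S \<sigma> \<le> K * \<bar>?S \<sigma>\<bar>" unfolding abs_mult[symmetric] by linarith
  qed
  also have "\<dots> \<le> K * sqrt (mean \<mu> (\<lambda>\<sigma>. (?S \<sigma>)\<^sup>2))"
    using mean_le_sqrt_mean_square[of \<mu> "\<lambda>\<sigma>. \<bar>?S \<sigma>\<bar>"] \<mu> K by (simp add: mult_left_mono)
  also have "\<dots> \<le> K * sqrt (mean U (\<lambda>i. mean U (\<lambda>j. \<bar>cov \<mu> (X i) (X j)\<bar>)))"
    using K by (intro mult_left_mono real_sqrt_le_mono mean_square_centered_average_le[OF \<mu> U])
      (simp_all add: sgn_if)
  finally show ?thesis .
qed

section \<open>Product measures and total variation\<close>

lemma finite_PiE_UNIV [simp]: "finite Y \<Longrightarrow> finite (PiE Y (\<lambda>_. UNIV :: 'o::finite set))"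
  by (intro finite_PiE) auto

lemma sum_PiE_insert:
  assumes "y \<notin> Y"
  shows "(\<Sum>\<tau>\<in>PiE (insert y Y) (\<lambda>_. UNIV). h \<tau>)
       = (\<Sum>t\<in>UNIV. \<Sum>\<tau>\<in>PiE Y (\<lambda>_. UNIV). h (\<tau>(y := t)))"
  unfolding PiE_insert_eq using inj_combinator[OF assms, of "\<lambda>_. UNIV"]
  by (subst sum.reindex) (simp_all add: sum.cartesian_product case_prod_unfold)

lemma set_Pi_pmf_subset_PiE: "finite Y \<Longrightarrow> set_pmf (Pi_pmf Y undefined u) \<subseteq> PiE Y (\<lambda>_. UNIV)"
  using set_Pi_pmf_subset[of Y undefined u] by (auto simp: PiE_def extensional_def)

lemma finite_set_Pi_pmf [simp]:
  fixes u :: "'v \<Rightarrow> 'o::finite pmf"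
  shows "finite Y \<Longrightarrow> finite (set_pmf (Pi_pmf Y undefined u))"
  by (rule finite_subset[OF set_Pi_pmf_subset_PiE]) auto

lemma mean_Pi_pmf:
  fixes u :: "'v \<Rightarrow> 'o::finite pmf"
  assumes "finite Y"
  shows "mean (Pi_pmf Y undefined u) h = (\<Sum>\<tau>\<in>PiE Y (\<lambda>_. UNIV). h \<tau> * pmf (Pi_pmf Y undefined u) \<tau>)"
  using assms set_Pi_pmf_subset_PiE[OF assms, of u] by (intro integral_measure_pmf_real) auto

lemma sum_pmf_Pi_pmf:
  fixes u :: "'v \<Rightarrow> 'o::finite pmf"
  assumes "finite Y"
  shows "(\<Sum>\<tau>\<in>PiE Y (\<lambda>_. UNIV). pmf (Pi_pmf Y undefined u) \<tau>) = 1"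
  using mean_Pi_pmf[OF assms, of u "\<lambda>_. 1"] by simp

lemma pmf_Pi_pmf_insert_upd:
  assumes "finite Y" "y \<notin> Y" "\<tau> \<in> PiE Y (\<lambda>_. UNIV)"
  shows "pmf (Pi_pmf (insert y Y) undefined u) (\<tau>(y := t)) = pmf (u y) t * pmf (Pi_pmf Y undefined u) \<tau>"
  using assms by (auto simp: pmf_Pi PiE_def extensional_def intro!: prod.cong)

lemma tv_dist_nonneg: "0 \<le> tv_dist p q"
  by (simp add: tv_dist_def sum_nonneg)

lemma tv_dist_pmf_le_1:
  fixes p q :: "'a::finite pmf"
  shows "tv_dist (pmf p) (pmf q) \<le> 1"
proof -
  have "(\<Sum>z\<in>UNIV. \<bar>pmf p z - pmf q z\<bar>) \<le> (\<Sum>z\<in>UNIV. pmf p z + pmf q z)"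
    by (intro sum_mono) (simp add: abs_le_iff add.commute[of "pmf p _"])
  then show ?thesis by (simp add: tv_dist_def sum.distrib sum_pmf_eq_1)
qed

lemma sum_abs_pmf_Pi_pmf_diff_le:
  fixes u v :: "'v \<Rightarrow> 'o::finite pmf"
  assumes "finite Y"
  shows "(\<Sum>\<tau>\<in>PiE Y (\<lambda>_. UNIV). \<bar>pmf (Pi_pmf Y undefined u) \<tau> - pmf (Pi_pmf Y undefined v) \<tau>\<bar>)
       \<le> (\<Sum>y\<in>Y. 2 * tv_dist (pmf (u y)) (pmf (v y)))"
  using assms
proof (induction Y)
  case (insert y Y)
  let ?p = "\<lambda>w. pmf (Pi_pmf Y undefined w)" and ?E = "PiE Y (\<lambda>_. UNIV :: 'o set)"
  have split: "\<bar>pmf (u y) t * ?p u \<tau> - pmf (v y) t * ?p v \<tau>\<bar>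
      \<le> \<bar>pmf (u y) t - pmf (v y) t\<bar> * ?p u \<tau> + pmf (v y) t * \<bar>?p u \<tau> - ?p v \<tau>\<bar>" for t \<tau>
  proof -
    have "pmf (u y) t * ?p u \<tau> - pmf (v y) t * ?p v \<tau>
        = (pmf (u y) t - pmf (v y) t) * ?p u \<tau> + pmf (v y) t * (?p u \<tau> - ?p v \<tau>)"
      by (simp add: algebra_simps)
    also have "\<bar>\<dots>\<bar> \<le> \<bar>(pmf (u y) t - pmf (v y) t) * ?p u \<tau>\<bar> + \<bar>pmf (v y) t * (?p u \<tau> - ?p v \<tau>)\<bar>"
      by (rule abs_triangle_ineq)
    finally show ?thesis by (simp add: abs_mult)
  qed
  have "(\<Sum>\<tau>\<in>PiE (insert y Y) (\<lambda>_. UNIV).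
        \<bar>pmf (Pi_pmf (insert y Y) undefined u) \<tau> - pmf (Pi_pmf (insert y Y) undefined v) \<tau>\<bar>)
      = (\<Sum>t\<in>UNIV. \<Sum>\<tau>\<in>?E. \<bar>pmf (u y) t * ?p u \<tau> - pmf (v y) t * ?p v \<tau>\<bar>)"
    unfolding sum_PiE_insert[OF insert(2)]
    by (intro sum.cong refl) (simp only: pmf_Pi_pmf_insert_upd[OF insert(1,2)])
  also have "\<dots> \<le> (\<Sum>t\<in>UNIV. \<Sum>\<tau>\<in>?E. \<bar>pmf (u y) t - pmf (v y) t\<bar> * ?p u \<tau> + pmf (v y) t * \<bar>?p u \<tau> - ?p v \<tau>\<bar>)"
    by (intro sum_mono split)
  also have "\<dots> = 2 * tv_dist (pmf (u y)) (pmf (v y)) + (\<Sum>\<tau>\<in>?E. \<bar>?p u \<tau> - ?p v \<tau>\<bar>)"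
    using insert(1) by (simp add: sum.distrib sum_distrib_left[symmetric] sum_distrib_right[symmetric]
        sum_pmf_Pi_pmf sum_pmf_eq_1 tv_dist_def)
  finally show ?case using insert by simp
qed simp

lemma mean_Pi_pmf_diff_le:
  fixes u v :: "'v \<Rightarrow> 'o::finite pmf"
  assumes Y: "finite Y" and h: "\<And>\<tau>. \<bar>h \<tau>\<bar> \<le> H"
  shows "\<bar>mean (Pi_pmf Y undefined u) h - mean (Pi_pmf Y undefined v) h\<bar>
       \<le> H * (\<Sum>y\<in>Y. 2 * tv_dist (pmf (u y)) (pmf (v y)))"
proof -
  let ?d = "\<lambda>\<tau>. pmf (Pi_pmf Y undefined u) \<tau> - pmf (Pi_pmf Y undefined v) \<tau>"
  have "\<bar>mean (Pi_pmf Y undefined u) h - mean (Pi_pmf Y undefined v) h\<bar>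
      = \<bar>\<Sum>\<tau>\<in>PiE Y (\<lambda>_. UNIV). h \<tau> * ?d \<tau>\<bar>"
    by (simp add: mean_Pi_pmf[OF Y] sum_subtractf right_diff_distrib)
  also have "\<dots> \<le> (\<Sum>\<tau>\<in>PiE Y (\<lambda>_. UNIV). \<bar>h \<tau>\<bar> * \<bar>?d \<tau>\<bar>)"
    unfolding abs_mult[symmetric] by (rule sum_abs)
  also have "\<dots> \<le> (\<Sum>\<tau>\<in>PiE Y (\<lambda>_. UNIV). H * \<bar>?d \<tau>\<bar>)"
    by (intro sum_mono mult_right_mono h) simp
  also have "\<dots> \<le> H * (\<Sum>y\<in>Y. 2 * tv_dist (pmf (u y)) (pmf (v y)))"
    using sum_abs_pmf_Pi_pmf_diff_le[OF Y, of u v] h[of undefined]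
    by (auto simp: sum_distrib_left[symmetric] intro!: mult_left_mono)
  finally show ?thesis .
qed

definition normalized :: "('a::finite \<Rightarrow> real) \<Rightarrow> 'a \<Rightarrow> real" where
  "normalized f s = f s / (\<Sum>t\<in>UNIV. f t)"

lemma normalized_divide_const: "c \<noteq> 0 \<Longrightarrow> normalized (\<lambda>s. f s / c) = normalized f"
  by (simp add: normalized_def fun_eq_iff sum_divide_distrib[symmetric])

lemma tv_dist_normalized_le:
  fixes f g :: "'a::finite \<Rightarrow> real"
  assumes L: "0 < L" "L \<le> sum f UNIV" and g: "\<And>s. 0 \<le> g s" "0 < sum g UNIV"
  shows "tv_dist (normalized f) (normalized g) \<le> (\<Sum>s\<in>UNIV. \<bar>f s - g s\<bar>) / L"
proof -
  let ?a = "sum f UNIV" and ?b = "sum g UNIV" and ?D = "\<Sum>s\<in>UNIV. \<bar>f s - g s\<bar>"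
  have a: "0 < ?a" using L by linarith
  have "\<bar>f s / ?a - g s / ?b\<bar> \<le> \<bar>f s - g s\<bar> / ?a + g s / ?b * (\<bar>?a - ?b\<bar> / ?a)" for s
  proof -
    have "f s / ?a - g s / ?b = (f s - g s) / ?a + g s / ?b * ((?b - ?a) / ?a)"
      using a g(2) by (simp add: field_simps)
    also have "\<bar>\<dots>\<bar> \<le> \<bar>(f s - g s) / ?a\<bar> + \<bar>g s / ?b * ((?b - ?a) / ?a)\<bar>" by (rule abs_triangle_ineq)
    also have "\<dots> = \<bar>f s - g s\<bar> / ?a + g s / ?b * (\<bar>?a - ?b\<bar> / ?a)"
      using a g by (simp add: abs_mult abs_minus_commute)
    finally show ?thesis .
  qed
  then have "(\<Sum>s\<in>UNIV. \<bar>f s / ?a - g s / ?b\<bar>)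
      \<le> (\<Sum>s\<in>UNIV. \<bar>f s - g s\<bar> / ?a + g s / ?b * (\<bar>?a - ?b\<bar> / ?a))"
    by (intro sum_mono)
  also have "\<dots> = ?D / ?a + \<bar>?a - ?b\<bar> / ?a"
    using g(2) by (simp add: sum.distrib sum_divide_distrib[symmetric] sum_distrib_right[symmetric])
  also have "\<dots> \<le> ?D / ?a + ?D / ?a"
    using a by (intro add_left_mono divide_right_mono) (auto simp: sum_subtractf[symmetric])
  also have "\<dots> \<le> ?D / L + ?D / L"
    using L a by (intro add_mono divide_left_mono mult_pos_pos sum_nonneg) auto
  also have "\<dots> = 2 * (?D / L)" by simp
  finally show ?thesis by (simp only: tv_dist_def normalized_def)
qed

section \<open>Approximate independence of random spins\<close>

abbreviation (input) spin :: "'v \<Rightarrow> 'o \<Rightarrow> ('v \<Rightarrow> 'o) \<Rightarrow> real" where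
  "spin y t \<sigma> \<equiv> of_bool (\<sigma> y = t)"

abbreviation marginal :: "('v \<Rightarrow> 'o) pmf \<Rightarrow> 'v \<Rightarrow> 'o pmf" where
  "marginal \<mu> y \<equiv> map_pmf (\<lambda>\<sigma>. \<sigma> y) \<mu>"

definition spin_cov :: "('v \<Rightarrow> 'o::finite) pmf \<Rightarrow> (('v \<Rightarrow> 'o) \<Rightarrow> real) \<Rightarrow> 'v \<Rightarrow> real" where
  "spin_cov \<mu> F y = (\<Sum>t\<in>UNIV. \<bar>cov \<mu> F (spin y t)\<bar>)"

definition pair_corr :: "'v pmf \<Rightarrow> ('v \<Rightarrow> 'o::finite) pmf \<Rightarrow> real" where
  "pair_corr U \<mu> = mean U (\<lambda>i. mean U (\<lambda>j. \<Sum>s\<in>UNIV. spin_cov \<mu> (spin i s) j))"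

text \<open>For \<open>F = 1\<close> this is twice the total variation distance between the joint law of the spins in \<open>Y\<close> and
  the product of its marginals.\<close>

definition dependence :: "('v \<Rightarrow> 'o::finite) pmf \<Rightarrow> (('v \<Rightarrow> 'o) \<Rightarrow> real) \<Rightarrow> 'v set \<Rightarrow> real" where
  "dependence \<mu> F Y = (\<Sum>\<tau>\<in>PiE Y (\<lambda>_. UNIV).
     \<bar>mean \<mu> (\<lambda>\<sigma>. F \<sigma> * of_bool (restrict \<sigma> Y = \<tau>)) - mean \<mu> F * pmf (Pi_pmf Y undefined (marginal \<mu>)) \<tau>\<bar>)"

lemma spin_cov_nonneg: "0 \<le> spin_cov \<mu> F y"
  unfolding spin_cov_def by (intro sum_nonneg) auto

lemma spin_cov_eq_0:
  assumes "\<forall>\<sigma>\<in>set_pmf \<mu>. \<sigma> x = s"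
  shows "spin_cov \<mu> F x = 0"
proof -
  have "cov \<mu> F (spin x t) = 0" for t
    by (rule cov_const_right[of _ _ "of_bool (s = t)"]) (simp add: assms)
  then show ?thesis by (simp add: spin_cov_def)
qed

lemma dependence_nonneg: "0 \<le> dependence \<mu> F Y"
  unfolding dependence_def by (intro sum_nonneg) auto

lemma pair_corr_nonneg: "0 \<le> pair_corr U \<mu>"
  unfolding pair_corr_def by (intro mean_nonneg sum_nonneg spin_cov_nonneg)

lemma mean_spin_cov_le:
  fixes \<mu> :: "('v \<Rightarrow> 'o::finite) pmf"
  assumes \<mu>: "finite (set_pmf \<mu>)" and U: "finite (set_pmf U)"
    and F: "\<And>\<sigma>. \<sigma> \<in> set_pmf \<mu> \<Longrightarrow> \<bar>F \<sigma>\<bar> \<le> K"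
  shows "mean U (spin_cov \<mu> F) \<le> CARD('o) * (K * sqrt (pair_corr U \<mu>))"
proof -
  have K: "0 \<le> K" using F by (rule abs_bound_nonneg)
  have "mean U (\<lambda>y. \<bar>cov \<mu> F (spin y t)\<bar>) \<le> K * sqrt (pair_corr U \<mu>)" for t
  proof -
    have "\<bar>cov \<mu> (spin i t) (spin j t)\<bar> \<le> spin_cov \<mu> (spin i t) j" for i j
      unfolding spin_cov_def by (rule member_le_sum) auto
    moreover have "spin_cov \<mu> (spin i t) j \<le> (\<Sum>s\<in>UNIV. spin_cov \<mu> (spin i s) j)" for i j
      by (rule member_le_sum[of t UNIV "\<lambda>s. spin_cov \<mu> (spin i s) j"]) (auto simp: spin_cov_nonneg)
    ultimately have "mean U (\<lambda>i. mean U (\<lambda>j. \<bar>cov \<mu> (spin i t) (spin j t)\<bar>)) \<le> pair_corr U \<mu>"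
      unfolding pair_corr_def by (intro mean_mono U) (rule order_trans)
    then show ?thesis
      using bessel_inequality[OF \<mu> U F, where X = "\<lambda>y. spin y t"] K
      by (meson mult_left_mono order_trans real_sqrt_le_mono)
  qed
  then have "(\<Sum>t\<in>(UNIV::'o set). mean U (\<lambda>y. \<bar>cov \<mu> F (spin y t)\<bar>))
      \<le> (\<Sum>t\<in>(UNIV::'o set). K * sqrt (pair_corr U \<mu>))"
    by (intro sum_mono)
  then show ?thesis unfolding spin_cov_def using U by simp
qed

lemma dependence_le_sum_spin:
  fixes \<mu> :: "('v \<Rightarrow> 'o::finite) pmf"
  assumes \<mu>: "finite (set_pmf \<mu>)"
  shows "dependence \<mu> F Y \<le> (\<Sum>t\<in>UNIV. dependence \<mu> (\<lambda>\<sigma>. F \<sigma> * spin y t \<sigma>) Y)"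
proof -
  have split: "mean \<mu> (\<lambda>\<sigma>. F \<sigma> * h \<sigma>) = (\<Sum>t\<in>UNIV. mean \<mu> (\<lambda>\<sigma>. F \<sigma> * spin y t \<sigma> * h \<sigma>))" for h
  proof -
    have "F \<sigma> * h \<sigma> = (\<Sum>t\<in>UNIV. F \<sigma> * spin y t \<sigma> * h \<sigma>)" for \<sigma>
      unfolding sum_distrib_right[symmetric] sum_distrib_left[symmetric] by (simp add: of_bool_def)
    then show ?thesis using \<mu> by (simp only: integral_sum' integrable_measure_pmf_finite simp_implies_def)
  qed
  have "dependence \<mu> F Y \<le> (\<Sum>\<tau>\<in>PiE Y (\<lambda>_. UNIV). \<Sum>t\<in>UNIV.
      \<bar>mean \<mu> (\<lambda>\<sigma>. F \<sigma> * spin y t \<sigma> * of_bool (restrict \<sigma> Y = \<tau>))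
        - mean \<mu> (\<lambda>\<sigma>. F \<sigma> * spin y t \<sigma>) * pmf (Pi_pmf Y undefined (marginal \<mu>)) \<tau>\<bar>)"
    unfolding dependence_def split[of "\<lambda>\<sigma>. of_bool (restrict \<sigma> Y = _)"] split[of "\<lambda>_. 1", simplified]
      sum_distrib_right sum_subtractf[symmetric]
    by (intro sum_mono sum_abs)
  also have "\<dots> = (\<Sum>t\<in>UNIV. dependence \<mu> (\<lambda>\<sigma>. F \<sigma> * spin y t \<sigma>) Y)"
    unfolding dependence_def by (rule sum.swap)
  finally show ?thesis .
qed

lemma dependence_insert_eq:
  fixes \<mu> :: "('v \<Rightarrow> 'o::finite) pmf"
  assumes Y: "finite Y" "y \<notin> Y"
  shows "dependence \<mu> F (insert y Y) = (\<Sum>t\<in>UNIV. \<Sum>\<tau>\<in>PiE Y (\<lambda>_. UNIV).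
      \<bar>mean \<mu> (\<lambda>\<sigma>. F \<sigma> * spin y t \<sigma> * of_bool (restrict \<sigma> Y = \<tau>))
        - mean \<mu> F * (mean \<mu> (spin y t) * pmf (Pi_pmf Y undefined (marginal \<mu>)) \<tau>)\<bar>)"
proof -
  have restrict_insert: "of_bool (restrict \<sigma> (insert y Y) = \<tau>(y := t))
      = spin y t \<sigma> * of_bool (restrict \<sigma> Y = \<tau>)"
    if "\<tau> \<in> PiE Y (\<lambda>_. UNIV)" for \<sigma> \<tau> t
  proof -
    have "restrict \<sigma> (insert y Y) = \<tau>(y := t) \<longleftrightarrow> \<sigma> y = t \<and> restrict \<sigma> Y = \<tau>"
      using that Y(2) by (auto simp: fun_eq_iff restrict_def PiE_def extensional_def)
    then show ?thesis by simp
  qed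
  show ?thesis
    unfolding dependence_def sum_PiE_insert[OF Y(2)]
    by (intro sum.cong refl)
      (simp only: restrict_insert pmf_Pi_pmf_insert_upd[OF Y] pmf_map_eq_mean mult.assoc)
qed

lemma dependence_insert_le:
  fixes \<mu> :: "('v \<Rightarrow> 'o::finite) pmf"
  assumes \<mu>: "finite (set_pmf \<mu>)" and Y: "finite Y"
  shows "dependence \<mu> F (insert y Y) \<le> spin_cov \<mu> F y + (\<Sum>t\<in>UNIV. dependence \<mu> (\<lambda>\<sigma>. F \<sigma> * spin y t \<sigma>) Y)"
proof (cases "y \<in> Y")
  case True
  then show ?thesis
    using dependence_le_sum_spin[OF \<mu>, of F Y y] spin_cov_nonneg[of \<mu> F y] by (simp add: insert_absorb)
next
  case False
  let ?p = "pmf (Pi_pmf Y undefined (marginal \<mu>))"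
  let ?E = "\<lambda>t \<tau>. mean \<mu> (\<lambda>\<sigma>. F \<sigma> * spin y t \<sigma> * of_bool (restrict \<sigma> Y = \<tau>))"
  have split: "\<bar>?E t \<tau> - mean \<mu> F * (mean \<mu> (spin y t) * ?p \<tau>)\<bar>
      \<le> \<bar>cov \<mu> F (spin y t)\<bar> * ?p \<tau> + \<bar>?E t \<tau> - mean \<mu> (\<lambda>\<sigma>. F \<sigma> * spin y t \<sigma>) * ?p \<tau>\<bar>" for t \<tau>
  proof -
    have "?E t \<tau> - mean \<mu> F * (mean \<mu> (spin y t) * ?p \<tau>)
        = cov \<mu> F (spin y t) * ?p \<tau> + (?E t \<tau> - mean \<mu> (\<lambda>\<sigma>. F \<sigma> * spin y t \<sigma>) * ?p \<tau>)"
      by (simp add: cov_def algebra_simps)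
    then show ?thesis
      using abs_triangle_ineq[of "cov \<mu> F (spin y t) * ?p \<tau>" "?E t \<tau> - mean \<mu> (\<lambda>\<sigma>. F \<sigma> * spin y t \<sigma>) * ?p \<tau>"]
      by (simp only: abs_mult[of _ "?p \<tau>"] abs_of_nonneg[OF pmf_nonneg])
  qed
  have "dependence \<mu> F (insert y Y)
      = (\<Sum>t\<in>UNIV. \<Sum>\<tau>\<in>PiE Y (\<lambda>_. UNIV). \<bar>?E t \<tau> - mean \<mu> F * (mean \<mu> (spin y t) * ?p \<tau>)\<bar>)"
    by (rule dependence_insert_eq[OF Y False])
  also have "\<dots> \<le> (\<Sum>t\<in>UNIV. \<Sum>\<tau>\<in>PiE Y (\<lambda>_. UNIV). \<bar>cov \<mu> F (spin y t)\<bar> * ?p \<tau>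
      + \<bar>?E t \<tau> - mean \<mu> (\<lambda>\<sigma>. F \<sigma> * spin y t \<sigma>) * ?p \<tau>\<bar>)"
    by (intro sum_mono split)
  also have "\<dots> = spin_cov \<mu> F y + (\<Sum>t\<in>UNIV. dependence \<mu> (\<lambda>\<sigma>. F \<sigma> * spin y t \<sigma>) Y)"
    by (simp add: sum.distrib sum_distrib_left[symmetric] sum_pmf_Pi_pmf[OF Y] spin_cov_def dependence_def)
  finally show ?thesis .
qed

lemma mean_dependence_le:
  fixes \<mu> :: "('v \<Rightarrow> 'o::finite) pmf"
  assumes \<mu>: "finite (set_pmf \<mu>)" and U: "finite (set_pmf U)"
    and F: "\<And>\<sigma>. \<sigma> \<in> set_pmf \<mu> \<Longrightarrow> \<bar>F \<sigma>\<bar> \<le> K"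
  shows "mean (replicate_pmf k U) (\<lambda>ys. dependence \<mu> F (set ys))
       \<le> k * real CARD('o) ^ k * (K * sqrt (pair_corr U \<mu>))"
  using F
proof (induction k arbitrary: F)
  case 0
  show ?case by (simp add: dependence_def restrict_def)
next
  case (Suc k)
  let ?q = "real CARD('o)" and ?R = "K * sqrt (pair_corr U \<mu>)"
  have K: "0 \<le> K" using Suc.prems by (rule abs_bound_nonneg)
  have IH: "mean (replicate_pmf k U) (\<lambda>ys. dependence \<mu> (\<lambda>\<sigma>. F \<sigma> * spin y t \<sigma>) (set ys))
      \<le> k * ?q ^ k * ?R" for y t
    using Suc.prems K by (intro Suc.IH) auto
  have "mean (replicate_pmf (Suc k) U) (\<lambda>ys. dependence \<mu> F (set ys))
      \<le> mean U (\<lambda>y. mean (replicate_pmf k U) (\<lambda>ys. spin_cov \<mu> F y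
          + (\<Sum>t\<in>UNIV. dependence \<mu> (\<lambda>\<sigma>. F \<sigma> * spin y t \<sigma>) (set ys))))"
    unfolding mean_replicate_pmf_Suc[OF U] list.set using U by (intro mean_mono dependence_insert_le \<mu>) auto
  also have "\<dots> = mean U (spin_cov \<mu> F)
      + mean U (\<lambda>y. \<Sum>t\<in>UNIV. mean (replicate_pmf k U) (\<lambda>ys. dependence \<mu> (\<lambda>\<sigma>. F \<sigma> * spin y t \<sigma>) (set ys)))"
    using U by simp
  also have "\<dots> \<le> ?q * ?R + mean U (\<lambda>y. \<Sum>t\<in>(UNIV::'o set). k * ?q ^ k * ?R)"
    by (intro add_mono mean_spin_cov_le \<mu> U Suc.prems mean_mono sum_mono IH)
  also have "\<dots> = ?q * ?R + k * ?q ^ Suc k * ?R" by simp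
  also have "\<dots> \<le> ?q ^ Suc k * ?R + k * ?q ^ Suc k * ?R"
  proof -
    have "1 \<le> ?q" by (simp add: Suc_leI)
    then have "?q \<le> ?q ^ Suc k" by (simp add: one_le_power)
    then show ?thesis
      using K by (intro add_right_mono mult_right_mono mult_nonneg_nonneg) (auto simp: pair_corr_nonneg)
  qed
  finally show ?case by (simp add: algebra_simps)
qed

lemma mean_local_function_diff_le:
  fixes \<mu> :: "('v \<Rightarrow> 'o::finite) pmf"
  assumes \<mu>: "finite (set_pmf \<mu>)" and Y: "finite Y"
    and h: "\<And>\<sigma>. h (restrict \<sigma> Y) = h \<sigma>" "\<And>\<sigma>. \<bar>h \<sigma>\<bar> \<le> H"
  shows "\<bar>mean \<mu> (\<lambda>\<sigma>. F \<sigma> * h \<sigma>) - mean \<mu> F * mean (Pi_pmf Y undefined (marginal \<mu>)) h\<bar> \<le> H * dependence \<mu> F Y"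
proof -
  let ?p = "pmf (Pi_pmf Y undefined (marginal \<mu>))"
  let ?E = "\<lambda>\<tau>. mean \<mu> (\<lambda>\<sigma>. F \<sigma> * of_bool (restrict \<sigma> Y = \<tau>))"
  have expand: "F \<sigma> * h \<sigma> = (\<Sum>\<tau>\<in>PiE Y (\<lambda>_. UNIV). h \<tau> * (F \<sigma> * of_bool (restrict \<sigma> Y = \<tau>)))" for \<sigma>
  proof -
    have "(\<Sum>\<tau>\<in>PiE Y (\<lambda>_. UNIV). h \<tau> * (F \<sigma> * of_bool (restrict \<sigma> Y = \<tau>)))
        = (\<Sum>\<tau>\<in>PiE Y (\<lambda>_. UNIV). if restrict \<sigma> Y = \<tau> then h \<tau> * F \<sigma> else 0)"
      by (intro sum.cong) auto
    then show ?thesis using Y h(1) by (simp add: mult.commute)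
  qed
  have "mean \<mu> (\<lambda>\<sigma>. F \<sigma> * h \<sigma>) = (\<Sum>\<tau>\<in>PiE Y (\<lambda>_. UNIV). h \<tau> * ?E \<tau>)"
    unfolding expand using \<mu> by simp
  then have "\<bar>mean \<mu> (\<lambda>\<sigma>. F \<sigma> * h \<sigma>) - mean \<mu> F * mean (Pi_pmf Y undefined (marginal \<mu>)) h\<bar>
      = \<bar>\<Sum>\<tau>\<in>PiE Y (\<lambda>_. UNIV). h \<tau> * (?E \<tau> - mean \<mu> F * ?p \<tau>)\<bar>"
    by (simp add: mean_Pi_pmf[OF Y] sum_distrib_left sum_subtractf right_diff_distrib mult_ac)
  also have "\<dots> \<le> (\<Sum>\<tau>\<in>PiE Y (\<lambda>_. UNIV). \<bar>h \<tau>\<bar> * \<bar>?E \<tau> - mean \<mu> F * ?p \<tau>\<bar>)"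
    unfolding abs_mult[symmetric] by (rule sum_abs)
  also have "\<dots> \<le> (\<Sum>\<tau>\<in>PiE Y (\<lambda>_. UNIV). H * \<bar>?E \<tau> - mean \<mu> F * ?p \<tau>\<bar>)"
    by (intro sum_mono mult_right_mono h) auto
  finally show ?thesis by (simp add: dependence_def sum_distrib_left)
qed

lemma cov_local_function_le:
  fixes \<mu> :: "('v \<Rightarrow> 'o::finite) pmf"
  assumes \<mu>: "finite (set_pmf \<mu>)" and Y: "finite Y"
    and h: "\<And>\<sigma>. h (restrict \<sigma> Y) = h \<sigma>" "\<And>\<sigma>. \<bar>h \<sigma>\<bar> \<le> H"
    and F: "\<And>\<sigma>. \<sigma> \<in> set_pmf \<mu> \<Longrightarrow> \<bar>F \<sigma>\<bar> \<le> K"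
  shows "\<bar>cov \<mu> F h\<bar> \<le> H * (dependence \<mu> F Y + K * dependence \<mu> (\<lambda>_. 1) Y)"
proof -
  let ?P = "mean (Pi_pmf Y undefined (marginal \<mu>)) h"
  have "0 \<le> H" using h(2)[of undefined] by linarith
  have "cov \<mu> F h = (mean \<mu> (\<lambda>\<sigma>. F \<sigma> * h \<sigma>) - mean \<mu> F * ?P) - mean \<mu> F * (mean \<mu> h - ?P)"
    by (simp add: cov_def algebra_simps)
  then have "\<bar>cov \<mu> F h\<bar> \<le> \<bar>mean \<mu> (\<lambda>\<sigma>. F \<sigma> * h \<sigma>) - mean \<mu> F * ?P\<bar> + \<bar>mean \<mu> F\<bar> * \<bar>mean \<mu> h - ?P\<bar>"
    unfolding abs_mult[symmetric] by linarith
  also have "\<dots> \<le> H * dependence \<mu> F Y + K * (H * dependence \<mu> (\<lambda>_. 1) Y)"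
    using mean_local_function_diff_le[of \<mu> Y h H F, OF \<mu> Y h]
      mean_local_function_diff_le[of \<mu> Y h H "\<lambda>_. 1", OF \<mu> Y h]
      abs_mean_le_bound[of \<mu> F K, OF \<mu> F] abs_bound_nonneg[of \<mu> F K, OF F]
    by (intro add_mono mult_mono) auto
  finally show ?thesis by (simp add: algebra_simps)
qed

section \<open>Gibbs measures\<close>

definition constraint_weight :: "'o weight \<times> nat list \<Rightarrow> (nat \<Rightarrow> 'o) \<Rightarrow> real" where
  "constraint_weight b \<sigma> = fst b (map \<sigma> (snd b))"

definition positive_weights :: "'o fgraph \<Rightarrow> bool" where
  "positive_weights G \<longleftrightarrow> (\<forall>b\<in>set G. \<forall>\<sigma>. 0 < constraint_weight b \<sigma>)"

abbreviation incident :: "nat \<Rightarrow> 'o weight \<times> nat list \<Rightarrow> bool" where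
  "incident x b \<equiv> x \<in> set (snd b)"

lemma weight_of_eq: "weight_of G \<sigma> = (\<Prod>b\<leftarrow>G. constraint_weight b \<sigma>)"
  by (simp add: weight_of_def constraint_weight_def case_prod_unfold)

lemma weight_of_Nil: "weight_of [] = (\<lambda>_. 1)"
  by (simp add: weight_of_def fun_eq_iff)

lemma weight_of_Cons: "weight_of (b # G) \<sigma> = constraint_weight b \<sigma> * weight_of G \<sigma>"
  by (simp add: weight_of_eq)

lemma weight_of_single: "weight_of [b] = constraint_weight b"
  by (simp add: fun_eq_iff weight_of_eq)

lemma weight_of_append: "weight_of (G @ H) \<sigma> = weight_of G \<sigma> * weight_of H \<sigma>"
  by (simp add: weight_of_eq)

lemma weight_of_perm: "mset G = mset H \<Longrightarrow> weight_of G = weight_of H"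
  by (simp add: fun_eq_iff weight_of_eq flip: prod_mset_prod_list)

lemma weight_of_pos: "positive_weights G \<Longrightarrow> 0 < weight_of G \<sigma>"
  unfolding weight_of_eq positive_weights_def by (induction G) auto

lemma weight_of_fun_upd:
  assumes "\<forall>b\<in>set G. \<not> incident x b"
  shows "weight_of G (\<sigma>(x := s)) = weight_of G \<sigma>"
  using assms by (induction G) (auto simp: weight_of_Nil weight_of_Cons constraint_weight_def)

lemma constraint_weight_restrict: "constraint_weight b (restrict \<sigma> (set (snd b))) = constraint_weight b \<sigma>"
  by (simp add: constraint_weight_def cong: map_cong)

lemma finite_configs [simp]: "finite (configs n :: (nat \<Rightarrow> 'o::finite) set)"
  unfolding configs_def by simp

lemma configs_not_empty: "configs n \<noteq> {}"
  by (simp add: configs_def PiE_eq_empty_iff)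

lemma partition_fun_pos:
  fixes G :: "'o::finite fgraph"
  assumes "positive_weights G"
  shows "0 < partition_fun n G"
  unfolding partition_fun_def using assms configs_not_empty by (intro sum_pos weight_of_pos) auto

definition gibbs_pmf :: "nat \<Rightarrow> 'o::finite fgraph \<Rightarrow> (nat \<Rightarrow> 'o) pmf" where
  "gibbs_pmf n G = embed_pmf (\<lambda>\<sigma>. if \<sigma> \<in> configs n then gibbs n G \<sigma> else 0)"

lemma pmf_gibbs_pmf:
  fixes G :: "'o::finite fgraph"
  assumes "positive_weights G"
  shows "pmf (gibbs_pmf n G) \<sigma> = (if \<sigma> \<in> configs n then gibbs n G \<sigma> else 0)"
  unfolding gibbs_pmf_def
proof (rule pmf_embed_pmf)
  have nonneg: "0 \<le> gibbs n G \<sigma>" for \<sigma>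
    using weight_of_pos[OF assms] partition_fun_pos[OF assms] by (simp add: gibbs_def less_imp_le)
  then show "0 \<le> (if \<sigma> \<in> configs n then gibbs n G \<sigma> else 0)" for \<sigma> by simp
  have "(\<integral>\<^sup>+\<sigma>. ennreal (if \<sigma> \<in> configs n then gibbs n G \<sigma> else 0) \<partial>count_space UNIV)
      = (\<Sum>\<sigma>\<in>configs n. ennreal (gibbs n G \<sigma>))"
    by (subst nn_integral_count_space'[of "configs n"]) auto
  also have "\<dots> = ennreal (\<Sum>\<sigma>\<in>configs n. gibbs n G \<sigma>)"
    using nonneg by (intro sum_ennreal) auto
  also have "(\<Sum>\<sigma>\<in>configs n. gibbs n G \<sigma>) = 1"
    using partition_fun_pos[OF assms, of n]
    by (simp add: gibbs_def sum_divide_distrib[symmetric] partition_fun_def)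
  finally show "(\<integral>\<^sup>+\<sigma>. ennreal (if \<sigma> \<in> configs n then gibbs n G \<sigma> else 0) \<partial>count_space UNIV) = 1"
    by simp
qed

lemma set_gibbs_pmf_subset: "positive_weights G \<Longrightarrow> set_pmf (gibbs_pmf n G) \<subseteq> configs n"
  by (auto simp: set_pmf_iff pmf_gibbs_pmf split: if_splits)

lemma finite_set_gibbs_pmf: "positive_weights G \<Longrightarrow> finite (set_pmf (gibbs_pmf n G))"
  using set_gibbs_pmf_subset finite_configs by (rule finite_subset)

lemma mean_gibbs_pmf:
  assumes "positive_weights G"
  shows "mean (gibbs_pmf n G) f = (\<Sum>\<sigma>\<in>configs n. weight_of G \<sigma> * f \<sigma>) / partition_fun n G"
proof -
  have "mean (gibbs_pmf n G) f = (\<Sum>\<sigma>\<in>configs n. f \<sigma> * pmf (gibbs_pmf n G) \<sigma>)"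
    using set_gibbs_pmf_subset[OF assms] by (intro integral_measure_pmf_real) auto
  then show ?thesis by (simp add: pmf_gibbs_pmf[OF assms] gibbs_def sum_divide_distrib mult.commute)
qed

lemma marg_eq_pmf:
  assumes "positive_weights G"
  shows "marg n G y = pmf (marginal (gibbs_pmf n G) y)"
  unfolding fun_eq_iff pmf_map_eq_mean mean_gibbs_pmf[OF assms] marg_def gibbs_def sum_divide_distrib
  by (auto intro!: sum.cong)

lemma marg2_eq_pmf:
  assumes "positive_weights G"
  shows "marg2 n G i j = pmf (map_pmf (\<lambda>\<sigma>. (\<sigma> i, \<sigma> j)) (gibbs_pmf n G))"
  unfolding fun_eq_iff pmf_map_eq_mean mean_gibbs_pmf[OF assms] marg2_def gibbs_def sum_divide_distrib
  by (auto intro!: sum.cong)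

lemma mean_gibbs_pmf_append:
  fixes c G :: "'o::finite fgraph"
  assumes "positive_weights c" "positive_weights G"
  shows "mean (gibbs_pmf n (c @ G)) f
       = mean (gibbs_pmf n G) (\<lambda>\<sigma>. weight_of c \<sigma> * f \<sigma>) / mean (gibbs_pmf n G) (weight_of c)"
proof -
  have "positive_weights (c @ G)" using assms by (auto simp: positive_weights_def)
  then have "mean (gibbs_pmf n (c @ G)) f
      = (\<Sum>\<sigma>\<in>configs n. weight_of G \<sigma> * (weight_of c \<sigma> * f \<sigma>)) / (\<Sum>\<sigma>\<in>configs n. weight_of G \<sigma> * weight_of c \<sigma>)"
    by (simp add: mean_gibbs_pmf partition_fun_def[of n "c @ G"] weight_of_append mult_ac)
  then show ?thesis
    using partition_fun_pos[OF assms(2), of n] by (simp add: mean_gibbs_pmf[OF assms(2)])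
qed

lemma marg_perm:
  assumes "mset G = mset H"
  shows "marg n G = marg n H"
proof -
  have "gibbs n G = gibbs n H"
    by (simp add: gibbs_def[abs_def] partition_fun_def weight_of_perm[OF assms])
  then show ?thesis by (simp only: marg_def[abs_def])
qed

lemma sum_spin_cov_gibbs_pmf:
  fixes G :: "'o::finite fgraph"
  assumes "positive_weights G"
  shows "(\<Sum>s\<in>UNIV. spin_cov (gibbs_pmf n G) (spin i s) j)
       = 2 * tv_dist (marg2 n G i j) (\<lambda>(s, t). marg n G i s * marg n G j t)"
proof -
  have "cov (gibbs_pmf n G) (spin i s) (spin j t) = marg2 n G i j (s, t) - marg n G i s * marg n G j t" for s t
    by (simp only: cov_def marg2_eq_pmf[OF assms] marg_eq_pmf[OF assms]
        pmf_map_eq_mean of_bool_conj prod.inject)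
  then show ?thesis
    by (simp add: spin_cov_def tv_dist_def sum.cartesian_product case_prod_unfold)
qed

lemma tv_dist_marg2_le_1:
  assumes "positive_weights G"
  shows "tv_dist (marg2 n G i j) (\<lambda>(s, t). marg n G i s * marg n G j t) \<le> 1"
proof -
  have "(\<lambda>(s, t). marg n G i s * marg n G j t)
      = pmf (pair_pmf (marginal (gibbs_pmf n G) i) (marginal (gibbs_pmf n G) j))"
    by (auto simp: fun_eq_iff marg_eq_pmf[OF assms] pmf_pair)
  then show ?thesis by (simp only: marg2_eq_pmf[OF assms] tv_dist_pmf_le_1)
qed

lemma pair_corr_gibbs_pmf:
  assumes "0 < n" "positive_weights G"
  shows "pair_corr (pmf_of_set {..<n}) (gibbs_pmf n G)
       = 2 / (real n)\<^sup>2 * (\<Sum>i<n. \<Sum>j<n. tv_dist (marg2 n G i j) (\<lambda>(s, t). marg n G i s * marg n G j t))"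
proof -
  have "mean (pmf_of_set {..<n}) f = (\<Sum>i<n. f i) / n" for f
    using assms(1) by (simp add: integral_pmf_of_set lessThan_empty_iff)
  then show ?thesis
    unfolding pair_corr_def sum_spin_cov_gibbs_pmf[OF assms(2)]
    by (simp add: sum_distrib_left[symmetric] sum_divide_distrib[symmetric] power2_eq_square)
qed

section \<open>Pinning the spin of an isolated variable\<close>

text \<open>Under the pinned measure the coordinates of a random tuple that equal \<open>x\<close> are
  deterministic and cause no error.\<close>

definition pin :: "'v \<Rightarrow> 'o \<Rightarrow> ('v \<Rightarrow> 'o) pmf \<Rightarrow> ('v \<Rightarrow> 'o) pmf" where
  "pin x s \<mu> = map_pmf (\<lambda>\<sigma>. \<sigma>(x := s)) \<mu>"

lemma finite_set_pin: "finite (set_pmf \<mu>) \<Longrightarrow> finite (set_pmf (pin x s \<mu>))"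
  by (simp add: pin_def)

lemma mean_pin: "mean (pin x s \<mu>) h = mean \<mu> (\<lambda>\<sigma>. h (\<sigma>(x := s)))"
  by (simp add: pin_def)

lemma marginal_pin: "marginal (pin x s \<mu>) y = (if y = x then return_pmf s else marginal \<mu> y)"
  by (simp add: pin_def pmf.map_comp comp_def)

lemma pair_corr_pin_le:
  assumes "finite (set_pmf U)"
  shows "pair_corr U (pin x s \<mu>) \<le> pair_corr U \<mu>"
proof -
  have "\<bar>cov (pin x s \<mu>) (spin i a) (spin j b)\<bar> \<le> \<bar>cov \<mu> (spin i a) (spin j b)\<bar>" for i j a b
  proof (cases "i = x \<or> j = x")
    case True
    have const: "cov (pin x s \<mu>) f (spin x t) = 0" for f t
      by (rule cov_const_right[of _ _ "of_bool (s = t)"]) (auto simp: pin_def)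
    from True have "cov (pin x s \<mu>) (spin i a) (spin j b) = 0"
    proof
      assume "i = x"
      then show ?thesis by (subst cov_commute) (simp only: const)
    next
      assume "j = x"
      then show ?thesis by (simp only: const)
    qed
    then show ?thesis by simp
  qed (simp add: cov_def mean_pin)
  then show ?thesis
    unfolding pair_corr_def spin_cov_def by (intro mean_mono sum_mono assms)
qed

lemma mean_spin_gibbs_pmf_isolated:
  fixes G :: "'o::finite fgraph"
  assumes x: "x < n" and G: "positive_weights G" "\<forall>b\<in>set G. \<not> incident x b"
  shows "mean (gibbs_pmf n G) (\<lambda>\<sigma>. h \<sigma> * spin x s \<sigma>) = mean (pin x s (gibbs_pmf n G)) h / CARD('o)"
proof -
  let ?E = "PiE ({..<n} - {x}) (\<lambda>_. UNIV :: 'o set)"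
  have configs: "(\<Sum>\<sigma>\<in>configs n. f \<sigma>) = (\<Sum>t\<in>UNIV. \<Sum>\<tau>\<in>?E. f (\<tau>(x := t)))" for f :: "_ \<Rightarrow> real"
    using sum_PiE_insert[of x "{..<n} - {x}" f] x by (simp add: configs_def insert_absorb)
  have upd: "weight_of G (\<tau>(x := t)) = weight_of G \<tau>" for \<tau> t by (rule weight_of_fun_upd[OF G(2)])
  have "(\<Sum>\<sigma>\<in>configs n. weight_of G \<sigma> * (h \<sigma> * spin x s \<sigma>)) = (\<Sum>\<tau>\<in>?E. weight_of G \<tau> * h (\<tau>(x := s)))"
    unfolding configs by (subst sum.swap) (simp add: upd of_bool_def if_distrib cong: if_cong)
  moreover have "(\<Sum>\<sigma>\<in>configs n. weight_of G \<sigma> * h (\<sigma>(x := s)))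
      = CARD('o) * (\<Sum>\<tau>\<in>?E. weight_of G \<tau> * h (\<tau>(x := s)))"
    unfolding configs by (simp add: upd)
  ultimately show ?thesis by (simp add: mean_gibbs_pmf[OF G(1)] mean_pin)
qed

lemma marg_append_isolated:
  fixes c G :: "'o::finite fgraph"
  assumes x: "x < n" and c: "positive_weights c" and G: "positive_weights G" "\<forall>b\<in>set G. \<not> incident x b"
  shows "marg n (c @ G) x = normalized (\<lambda>s. mean (pin x s (gibbs_pmf n G)) (weight_of c))"
proof
  fix s
  let ?\<mu> = "gibbs_pmf n G"
  have pinned: "mean ?\<mu> (\<lambda>\<sigma>. weight_of c \<sigma> * spin x t \<sigma>) = mean (pin x t ?\<mu>) (weight_of c) / CARD('o)" for t
    by (rule mean_spin_gibbs_pmf_isolated[OF x G])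
  have "mean ?\<mu> (weight_of c) = mean ?\<mu> (\<lambda>\<sigma>. \<Sum>t\<in>UNIV. weight_of c \<sigma> * spin x t \<sigma>)"
    by (simp add: sum_distrib_left[symmetric] of_bool_def)
  also have "\<dots> = (\<Sum>t\<in>UNIV. mean (pin x t ?\<mu>) (weight_of c)) / CARD('o)"
    unfolding sum_divide_distrib pinned[symmetric] using finite_set_gibbs_pmf[OF G(1)]
    by (intro Bochner_Integration.integral_sum) simp
  finally have total: "mean ?\<mu> (weight_of c) = (\<Sum>t\<in>UNIV. mean (pin x t ?\<mu>) (weight_of c)) / CARD('o)" .
  have "positive_weights (c @ G)" using c G(1) by (auto simp: positive_weights_def)
  then have "marg n (c @ G) x s = mean (gibbs_pmf n (c @ G)) (spin x s)"
    by (simp only: marg_eq_pmf pmf_map_eq_mean)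
  also have "\<dots> = mean ?\<mu> (\<lambda>\<sigma>. weight_of c \<sigma> * spin x s \<sigma>) / mean ?\<mu> (weight_of c)"
    by (rule mean_gibbs_pmf_append[OF c G(1)])
  finally show "marg n (c @ G) x s = normalized (\<lambda>s. mean (pin x s ?\<mu>) (weight_of c)) s"
    unfolding pinned total by (simp add: normalized_def)
qed

section \<open>Decomposition of the Belief Propagation error\<close>

definition variable_error :: "nat \<Rightarrow> nat \<Rightarrow> 'o::finite fgraph \<Rightarrow> real" where
  "variable_error n x G = tv_dist (marg n G x)
     (normalized (\<lambda>s. \<Prod>b\<leftarrow>filter (incident x) G. marg n (b # filter (\<lambda>b. \<not> incident x b) G) x s))"

definition bp_sum :: "'o::finite weight \<times> nat list \<Rightarrow> nat \<Rightarrow> (nat \<Rightarrow> 'o \<Rightarrow> real) \<Rightarrow> 'o \<Rightarrow> real" where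
  "bp_sum b x m s = (\<Sum>\<tau>\<in>PiE (set (snd b)) (\<lambda>_. UNIV).
     if \<tau> x = s then constraint_weight b \<tau> * (\<Prod>y\<in>set (snd b) - {x}. m y (\<tau> y)) else 0)"

definition constraint_error :: "nat \<Rightarrow> nat \<Rightarrow> 'o::finite weight \<times> nat list \<Rightarrow> 'o fgraph \<Rightarrow> real" where
  "constraint_error n x b G =
     tv_dist (marg n (b # filter (\<lambda>b. \<not> incident x b) G) x) (normalized (bp_sum b x (marg n G)))"

text \<open>The error of the pair \<open>(x, b)\<close>, where \<open>G\<close> is the factor graph without the constraint \<open>b\<close>.\<close>

definition local_error :: "nat \<Rightarrow> nat \<Rightarrow> 'o::finite weight \<times> nat list \<Rightarrow> 'o fgraph \<Rightarrow> real" where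
  "local_error n x b G = variable_error n x G + constraint_error n x b G"

lemma local_error_nonneg: "0 \<le> local_error n x b G"
  by (simp add: local_error_def variable_error_def constraint_error_def tv_dist_nonneg)

lemma variable_error_perm:
  assumes "mset G = mset H"
  shows "variable_error n x G = variable_error n x H"
proof -
  have "marg n (b # filter Q G) = marg n (b # filter Q H)" for b Q
    by (rule marg_perm) (simp add: assms)
  moreover have "(\<Prod>b\<leftarrow>filter Q G. f b) = (\<Prod>b\<leftarrow>filter Q H. f b)" for Q and f :: "_ \<Rightarrow> real"
    by (simp add: assms flip: prod_mset_prod_list)
  ultimately show ?thesis by (simp add: variable_error_def marg_perm[OF assms])
qed

lemma constraint_error_perm:
  assumes "mset G = mset H"
  shows "constraint_error n x b G = constraint_error n x b H"
proof -
  have "marg n (b # filter Q G) = marg n (b # filter Q H)" for Q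
    by (rule marg_perm) (simp add: assms)
  then show ?thesis by (simp add: constraint_error_def marg_perm[OF assms])
qed

lemma local_error_perm: "mset G = mset H \<Longrightarrow> local_error n x b G = local_error n x b H"
  unfolding local_error_def by (intro arg_cong2[of _ _ _ _ plus] variable_error_perm constraint_error_perm)

lemma bp_sum_eq_mean_Pi_pmf:
  assumes x: "incident x b"
  shows "bp_sum b x (\<lambda>y. pmf (u y)) s
       = mean (Pi_pmf (set (snd b)) undefined (u(x := return_pmf s))) (constraint_weight b)"
proof -
  let ?Y = "set (snd b)"
  have "(if \<tau> x = s then constraint_weight b \<tau> * (\<Prod>y\<in>?Y - {x}. pmf (u y) (\<tau> y)) else 0)
      = constraint_weight b \<tau> * pmf (Pi_pmf ?Y undefined (u(x := return_pmf s))) \<tau>"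
    if "\<tau> \<in> PiE ?Y (\<lambda>_. UNIV)" for \<tau>
  proof -
    have "pmf (Pi_pmf ?Y undefined (u(x := return_pmf s))) \<tau> = (\<Prod>y\<in>?Y. pmf ((u(x := return_pmf s)) y) (\<tau> y))"
      using that by (intro pmf_Pi') auto
    also have "\<dots> = indicator {s} (\<tau> x) * (\<Prod>y\<in>?Y - {x}. pmf ((u(x := return_pmf s)) y) (\<tau> y))"
      using x by (subst prod.remove[of _ x]) (auto simp: indicator_def)
    also have "(\<Prod>y\<in>?Y - {x}. pmf ((u(x := return_pmf s)) y) (\<tau> y)) = (\<Prod>y\<in>?Y - {x}. pmf (u y) (\<tau> y))"
      by (intro prod.cong) auto
    finally have factor: "pmf (Pi_pmf ?Y undefined (u(x := return_pmf s))) \<tau>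
        = indicator {s} (\<tau> x) * (\<Prod>y\<in>?Y - {x}. pmf (u y) (\<tau> y))" .
    show ?thesis unfolding factor by simp
  qed
  then show ?thesis unfolding bp_sum_def by (simp add: mean_Pi_pmf)
qed

lemma sum_bp_sum:
  "(\<Sum>s\<in>UNIV. bp_sum b x m s) = (\<Sum>\<tau>\<in>PiE (set (snd b)) (\<lambda>_. UNIV).
     constraint_weight b \<tau> * (\<Prod>y\<in>set (snd b) - {x}. m y (\<tau> y)))"
  unfolding bp_sum_def by (subst sum.swap) simp

lemma mset_del_constraints:
  "mset (del_constraints G D) = image_mset (nth G) (mset_set ({..<length G} - D))"
proof -
  let ?js = "filter (\<lambda>i. i \<notin> D) [0..<length G]"
  have "mset ?js = mset_set (set ?js)" by (subst mset_set_set) auto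
  moreover have "set ?js = {..<length G} - D" by auto
  ultimately show ?thesis by (simp only: del_constraints_def mset_map)
qed

lemma mset_del_constraints_delete_nth:
  assumes "a < length G"
  shows "mset (del_constraints G {a}) = mset (delete_nth a G)"
proof -
  have "mset (del_constraints G {}) = mset G"
    by (simp add: del_constraints_def map_nth)
  then have "mset (G ! a # del_constraints G {a}) = mset (G ! a # delete_nth a G)"
    unfolding mset_nth_delete_nth[OF assms] using assms
    by (simp add: mset_del_constraints mset_set.remove)
  then show ?thesis by simp
qed

context
  fixes n x a :: nat and G :: "'o::finite fgraph"
  assumes a: "a \<in> adj_var G x"
begin

lemma mset_filter_del_constraints:
  "mset (filter (incident x) (del_constraints G {a})) = image_mset (nth G) (mset_set (adj_var G x - {a}))"
  "mset (filter (\<lambda>b. \<not> incident x b) (del_constraints G {a}))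
       = image_mset (nth G) (mset_set ({..<length G} - adj_var G x))"
proof -
  have sets: "{i. i < length G \<and> i \<noteq> a \<and> incident x (G ! i)} = adj_var G x - {a}"
    "{i. i < length G \<and> i \<noteq> a \<and> \<not> incident x (G ! i)} = {..<length G} - adj_var G x"
    using a by (auto simp: adj_var_def)
  show "mset (filter (incident x) (del_constraints G {a})) = image_mset (nth G) (mset_set (adj_var G x - {a}))"
    "mset (filter (\<lambda>b. \<not> incident x b) (del_constraints G {a}))
       = image_mset (nth G) (mset_set ({..<length G} - adj_var G x))"
    unfolding mset_filter mset_del_constraints filter_mset_image_mset by (simp_all add: comp_def sets)
qed

lemma msg_av_eq_marg:
  assumes "a' \<in> adj_var G x"
  shows "msg_av n G a' x = marg n (G ! a' # filter (\<lambda>b. \<not> incident x b) (del_constraints G {a})) x"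
proof -
  have "{..<length G} - (adj_var G x - {a'}) = insert a' ({..<length G} - adj_var G x)"
    using assms by (auto simp: adj_var_def)
  then have perm: "mset (del_constraints G (adj_var G x - {a'}))
      = mset (G ! a' # filter (\<lambda>b. \<not> incident x b) (del_constraints G {a}))"
    using assms by (simp add: mset_del_constraints mset_filter_del_constraints(2) del: mset_filter)
  show ?thesis unfolding msg_av_def marg_perm[OF perm] ..
qed

lemma tv_dist_msg_va:
  "tv_dist (msg_va n G x a) (normalized (\<lambda>s. \<Prod>b\<in>adj_var G x - {a}. msg_av n G b x s))
     = variable_error n x (del_constraints G {a})"
proof -
  let ?H = "filter (\<lambda>b. \<not> incident x b) (del_constraints G {a})"
  have "(\<Prod>b\<in>adj_var G x - {a}. msg_av n G b x s)
      = (\<Prod>b\<leftarrow>filter (incident x) (del_constraints G {a}). marg n (b # ?H) x s)" for s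
  proof -
    have "(\<Prod>b\<in>adj_var G x - {a}. msg_av n G b x s) = (\<Prod>b\<in>adj_var G x - {a}. marg n (G ! b # ?H) x s)"
      by (intro prod.cong) (auto simp: msg_av_eq_marg)
    also have "\<dots> = prod_mset (image_mset (\<lambda>b. marg n (b # ?H) x s)
        (mset (filter (incident x) (del_constraints G {a}))))"
      unfolding mset_filter_del_constraints(1) prod_unfold_prod_mset
      by (simp add: image_mset.compositionality comp_def del: mset_filter)
    finally show ?thesis by (simp only: mset_map[symmetric] prod_mset_prod_list)
  qed
  then show ?thesis by (simp only: variable_error_def msg_va_def)
qed

lemma tv_dist_msg_av:
  "tv_dist (msg_av n G a x) (normalized (bp_sum (G ! a) x (\<lambda>y. msg_va n G y a)))
     = constraint_error n x (G ! a) (del_constraints G {a})"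
  unfolding constraint_error_def msg_av_eq_marg[OF a] msg_va_def ..

end

lemma bp_error_eq:
  "bp_error n G = 2 * (\<Sum>x<n. \<Sum>a\<in>adj_var G x.
     local_error n x (G ! a) (delete_nth a G))"
proof -
  let ?va = "\<lambda>x a s. \<bar>msg_va n G x a s - normalized (\<lambda>s. \<Prod>b\<in>adj_var G x - {a}. msg_av n G b x s) s\<bar>"
  let ?av = "\<lambda>x a s. \<bar>msg_av n G a x s - normalized (bp_sum (G ! a) x (\<lambda>y. msg_va n G y a)) s\<bar>"
  have errors: "2 * local_error n x (G ! a) (delete_nth a G)
      = (\<Sum>s\<in>UNIV. ?va x a s + ?av x a s)" if a: "a \<in> adj_var G x" for x a
  proof -
    have perm: "mset (delete_nth a G) = mset (del_constraints G {a})"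
      using a by (intro mset_del_constraints_delete_nth[symmetric]) (simp add: adj_var_def)
    have "local_error n x (G ! a) (delete_nth a G)
        = ((\<Sum>s\<in>UNIV. ?va x a s) + (\<Sum>s\<in>UNIV. ?av x a s)) / 2"
      unfolding local_error_perm[OF perm] unfolding local_error_def
        tv_dist_msg_va[OF a, symmetric] tv_dist_msg_av[OF a, symmetric]
      by (simp only: tv_dist_def add_divide_distrib)
    then show ?thesis by (simp add: sum.distrib)
  qed
  have "bp_error n G = (\<Sum>x<n. \<Sum>a\<in>adj_var G x. \<Sum>s\<in>UNIV. ?va x a s + ?av x a s)"
    unfolding normalized_def sum_bp_sum unfolding bp_error_def vars_of_def bp_sum_def constraint_weight_def ..
  then show ?thesis by (simp only: sum_distrib_left errors cong: sum.cong)
qed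

section \<open>Uniformly random tuples\<close>

lemma pmf_replicate_pmf: "length ys = k \<Longrightarrow> pmf (replicate_pmf k p) ys = (\<Prod>y\<leftarrow>ys. pmf p y)"
proof (induction ys arbitrary: k)
  case (Cons y ys)
  then obtain k' where k: "k = Suc k'" "length ys = k'" by auto
  have "replicate_pmf k p = map_pmf (\<lambda>(y, ys). y # ys) (pair_pmf p (replicate_pmf k' p))"
    by (simp add: k pair_pmf_def map_bind_pmf)
  also have "pmf \<dots> (y # ys) = pmf (pair_pmf p (replicate_pmf k' p)) (y, ys)"
    using pmf_map_inj'[of "\<lambda>(y, ys). y # ys" _ "(y, ys)"] by (auto simp: inj_def)
  finally show ?case using Cons.IH[OF k(2)] by (simp add: pmf_pair)
qed simp

lemma random_tuple_eq_replicate_pmf: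
  assumes "0 < n"
  shows "random_tuple n k = replicate_pmf k (pmf_of_set {..<n})"
proof (rule pmf_eqI)
  fix ys
  let ?L = "{ys. length ys = k \<and> set ys \<subseteq> {..<n}}"
  have fin: "finite ?L" and card: "card ?L = n ^ k"
    using finite_lists_length_eq[of "{..<n}" k] card_lists_length_eq[of "{..<n}" k]
    by (simp_all add: conj_commute)
  have "replicate k 0 \<in> ?L" using assms by auto
  then have "?L \<noteq> {}" by blast
  then have "pmf (random_tuple n k) ys = indicator ?L ys / real n ^ k"
    unfolding random_tuple_def using fin card by (subst pmf_of_set) auto
  moreover have "pmf (replicate_pmf k (pmf_of_set {..<n})) ys = indicator ?L ys / real n ^ k"
  proof (cases "ys \<in> ?L")
    case True
    then have "(\<Prod>y\<leftarrow>ys. pmf (pmf_of_set {..<n}) y) = (\<Prod>y\<leftarrow>ys. 1 / real n)"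
      using assms by (intro arg_cong[of _ _ prod_list] map_cong) (auto simp: lessThan_empty_iff)
    also have "\<dots> = 1 / real n ^ k" using True
      by (simp add: prod_list_replicate map_replicate_const power_one_over)
    finally show ?thesis using True by (simp add: pmf_replicate_pmf)
  next
    case False
    then show ?thesis
      using assms by (simp add: pmf_eq_0_set_pmf in_set_replicate_pmf set_pmf_of_set lessThan_empty_iff)
  qed
  ultimately show "pmf (random_tuple n k) ys = pmf (replicate_pmf k (pmf_of_set {..<n})) ys" by simp
qed

lemma mean_replicate_pmf_member_le:
  fixes D :: "'a list \<Rightarrow> real"
  assumes U: "finite (set_pmf U)"
    and perm: "\<And>ys zs. mset ys = mset zs \<Longrightarrow> D ys = D zs" and D: "\<And>ys. 0 \<le> D ys"
  shows "mean (replicate_pmf (Suc k) U) (\<lambda>ys. of_bool (x \<in> set ys) * D ys)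
       \<le> Suc k * (pmf U x * mean (replicate_pmf k U) (\<lambda>ys. D (x # ys)))"
proof -
  let ?h = "\<lambda>y ys. of_bool (y = x) * D (x # ys)"
  have pointwise: "of_bool (x \<in> set ys) * D ys \<le> (\<Sum>i<Suc k. ?h (ys ! i) (delete_nth i ys))"
    if len: "length ys = Suc k" for ys
  proof (cases "x \<in> set ys")
    case True
    then obtain i where i: "i < Suc k" "ys ! i = x" using len by (auto simp: in_set_conv_nth)
    have "D ys = D (ys ! i # delete_nth i ys)"
      using i len by (intro perm mset_nth_delete_nth[symmetric]) simp
    then have "D ys = ?h (ys ! i) (delete_nth i ys)" by (simp only: i of_bool_eq mult_1 simp_thms)
    also have "\<dots> \<le> (\<Sum>i<Suc k. ?h (ys ! i) (delete_nth i ys))"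
      using i D by (intro member_le_sum) auto
    finally show ?thesis using True by (simp only: of_bool_eq mult_1 simp_thms)
  next
    case False
    then show ?thesis using D by (simp add: sum_nonneg del: sum.lessThan_Suc)
  qed
  have "mean (replicate_pmf (Suc k) U) (\<lambda>ys. of_bool (x \<in> set ys) * D ys)
      \<le> mean (replicate_pmf (Suc k) U) (\<lambda>ys. \<Sum>i<Suc k. ?h (ys ! i) (delete_nth i ys))"
    by (intro mean_mono finite_set_replicate_pmf U pointwise) (simp only: in_set_replicate_pmf)
  also have "\<dots> = (\<Sum>i<Suc k. mean (replicate_pmf (Suc k) U) (\<lambda>ys. ?h (ys ! i) (delete_nth i ys)))"
    by (intro Bochner_Integration.integral_sum integrable_measure_pmf_finite finite_set_replicate_pmf U)
  also have "\<dots> = (\<Sum>i<Suc k. mean U (\<lambda>y. mean (replicate_pmf k U) (?h y)))"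
    by (intro sum.cong refl mean_nth_delete_nth_replicate_pmf U) simp
  also have "\<dots> = Suc k * (mean U (\<lambda>y. of_bool (y = x)) * mean (replicate_pmf k U) (\<lambda>ys. D (x # ys)))"
    by simp
  also have "mean U (\<lambda>y. of_bool (y = x)) = pmf U x"
    using pmf_map_eq_mean[of "\<lambda>y. y" U x] by simp
  finally show ?thesis .
qed

lemma random_fgraph_eq: "random_fgraph d k \<rho> n = poisson_list_pmf (d * n / k) (pair_pmf \<rho> (random_tuple n k))"
  by (simp add: random_fgraph_def poisson_list_pmf_def)

section \<open>Random constraints with bounded weights\<close>

lemma prod_list_bounds:
  fixes f :: "'a \<Rightarrow> real"
  assumes "1 \<le> \<Lambda>" "\<And>b. b \<in> set c \<Longrightarrow> 1 / \<Lambda> \<le> f b \<and> f b \<le> \<Lambda>"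
  shows "1 / \<Lambda> ^ length c \<le> (\<Prod>b\<leftarrow>c. f b) \<and> (\<Prod>b\<leftarrow>c. f b) \<le> \<Lambda> ^ length c"
  using assms(2)
proof (induction c)
  case (Cons b c)
  have IH: "1 / \<Lambda> ^ length c \<le> (\<Prod>b\<leftarrow>c. f b)" "(\<Prod>b\<leftarrow>c. f b) \<le> \<Lambda> ^ length c"
    using Cons by auto
  have b: "1 / \<Lambda> \<le> f b" "f b \<le> \<Lambda>" using Cons.prems by auto
  have "0 \<le> 1 / \<Lambda> ^ length c" using assms(1) by simp
  with IH(1) have "0 \<le> (\<Prod>b\<leftarrow>c. f b)" by linarith
  then have "f b * (\<Prod>b\<leftarrow>c. f b) \<le> \<Lambda> * \<Lambda> ^ length c"
    using IH(2) b assms(1) by (intro mult_mono) auto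
  moreover have "1 / \<Lambda> * (1 / \<Lambda> ^ length c) \<le> f b * (\<Prod>b\<leftarrow>c. f b)"
    using IH(1) b assms(1) by (intro mult_mono order_trans[OF _ b(1)]) auto
  ultimately show ?case by simp
qed simp

lemma prod_list_divide:
  fixes f g :: "'a \<Rightarrow> real"
  shows "(\<Prod>b\<leftarrow>c. f b / g b) = (\<Prod>b\<leftarrow>c. f b) / (\<Prod>b\<leftarrow>c. g b)"
  by (induction c) auto

lemma sum_set_le_sum_list:
  fixes f :: "'a \<Rightarrow> real"
  assumes "\<And>y. 0 \<le> f y"
  shows "(\<Sum>y\<in>set ys. f y) \<le> (\<Sum>y\<leftarrow>ys. f y)"
proof (induction ys)
  case (Cons y ys)
  then show ?case using assms[of y] by (cases "y \<in> set ys") (auto simp: insert_absorb)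
qed simp

definition product_error :: "(nat \<Rightarrow> 'o) pmf \<Rightarrow> ((nat \<Rightarrow> 'o) \<Rightarrow> real) \<Rightarrow> 'o fgraph \<Rightarrow> real" where
  "product_error \<nu> F c = \<bar>mean \<nu> (\<lambda>\<sigma>. F \<sigma> * weight_of c \<sigma>) - mean \<nu> F * (\<Prod>b\<leftarrow>c. mean \<nu> (constraint_weight b))\<bar>"

definition marginal_shift :: "nat \<Rightarrow> nat \<Rightarrow> 'o::finite fgraph \<Rightarrow> 'o fgraph \<Rightarrow> nat \<Rightarrow> real" where
  "marginal_shift n x c G y = (if y = x then 0 else 2 * tv_dist (marg n G y) (marg n (c @ G) y))"

lemma marginal_shift_nonneg: "0 \<le> marginal_shift n x c G y"
  by (simp add: marginal_shift_def tv_dist_nonneg)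

lemma filter_incident_append:
  assumes "\<forall>b\<in>set c. incident x b" "\<forall>b\<in>set G. \<not> incident x b"
  shows "filter (incident x) (c @ G) = c" "filter (\<lambda>b. \<not> incident x b) (c @ G) = G"
  using assms by (auto simp: filter_id_conv filter_empty_conv)

locale bounded_weights =
  fixes k :: nat and d \<Lambda> :: real and \<rho> :: "'o::finite weight pmf"
  assumes k_pos: "0 < k" and d_pos: "0 < d" and \<Lambda>_ge_1: "1 \<le> \<Lambda>"
    and finite_\<rho>: "finite (set_pmf \<rho>)"
    and weight_bounds: "\<And>\<psi> \<tau>. \<psi> \<in> set_pmf \<rho> \<Longrightarrow> length \<tau> = k \<Longrightarrow> 1 / \<Lambda> \<le> \<psi> \<tau> \<and> \<psi> \<tau> \<le> \<Lambda>"
begin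

abbreviation vertex_pmf :: "nat \<Rightarrow> nat pmf" where
  "vertex_pmf n \<equiv> pmf_of_set {..<n}"

abbreviation constraint_pmf :: "nat \<Rightarrow> ('o weight \<times> nat list) pmf" where
  "constraint_pmf n \<equiv> pair_pmf \<rho> (random_tuple n k)"

abbreviation incident_mean :: "nat \<Rightarrow> nat \<Rightarrow> ('o weight \<times> nat list \<Rightarrow> real) \<Rightarrow> real" where
  "incident_mean n x \<equiv> intensity_integral (d * n / k) (constraint_pmf n) (incident x)"

abbreviation incident_mean_list :: "nat \<Rightarrow> nat \<Rightarrow> nat \<Rightarrow> ('o fgraph \<Rightarrow> real) \<Rightarrow> real" where
  "incident_mean_list n x \<equiv> intensity_integral_list (d * n / k) (constraint_pmf n) (incident x)"

definition product_error_base :: real where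
  "product_error_base = 1 + 2 * d * \<Lambda> * k * real CARD('o) ^ k"

definition local_error_const :: real where
  "local_error_const = 2 * d * \<Lambda>\<^sup>2 * k * real CARD('o) ^ Suc k"

definition bp_error_const :: real where
  "bp_error_const = 2 * (local_error_const * exp (2 * \<Lambda> * product_error_base))"

lemma rate_nonneg: "0 \<le> d * real n / real k"
  using d_pos by simp

lemma card_spins_ge_1: "1 \<le> real CARD('o)"
  by (simp add: Suc_leI)

lemma product_error_base_ge:
  "1 \<le> product_error_base" "\<Lambda> * d \<le> product_error_base"
  "2 * d * \<Lambda> * k * real CARD('o) ^ k \<le> product_error_base"
proof -
  have "1 \<le> real k * real CARD('o) ^ k"
    using mult_mono[of 1 "real k" 1 "real CARD('o) ^ k"] k_pos card_spins_ge_1 by (simp add: one_le_power)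
  then have "\<Lambda> * d \<le> \<Lambda> * d * (real k * real CARD('o) ^ k)"
    using \<Lambda>_ge_1 d_pos by simp
  moreover have "0 \<le> \<Lambda> * d" using \<Lambda>_ge_1 d_pos by simp
  ultimately show "1 \<le> product_error_base" "\<Lambda> * d \<le> product_error_base"
    "2 * d * \<Lambda> * k * real CARD('o) ^ k \<le> product_error_base"
    unfolding product_error_base_def by (simp_all add: mult_ac)
qed

lemma product_error_base_Suc_ge:
  fixes r :: nat
  assumes "0 \<le> R"
  shows "r * product_error_base ^ r * (\<Lambda> * R) * d
         + product_error_base ^ r * (2 * d * \<Lambda> * k * real CARD('o) ^ k * R)
       \<le> Suc r * product_error_base ^ Suc r * R"
proof -
  let ?M = product_error_base
  have "0 \<le> ?M ^ r" using product_error_base_ge(1) by simp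
  then have "(\<Lambda> * d) * (r * ?M ^ r * R) + (2 * d * \<Lambda> * k * real CARD('o) ^ k) * (?M ^ r * R)
      \<le> ?M * (r * ?M ^ r * R) + ?M * (?M ^ r * R)"
    using assms by (intro add_mono mult_right_mono product_error_base_ge) auto
  then show ?thesis by (simp add: algebra_simps)
qed

lemma power_le_product_error_base: "\<Lambda> ^ (2 * r) * d ^ r \<le> (\<Lambda> * product_error_base) ^ r"
proof -
  have "\<Lambda> ^ (2 * r) * d ^ r = (\<Lambda> * (\<Lambda> * d)) ^ r"
    by (simp add: power_mult power_mult_distrib power2_eq_square mult.assoc)
  also have "\<dots> \<le> (\<Lambda> * product_error_base) ^ r"
    using \<Lambda>_ge_1 d_pos by (intro power_mono mult_left_mono product_error_base_ge) auto
  finally show ?thesis .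
qed

lemma local_error_const_nonneg: "0 \<le> local_error_const"
  unfolding local_error_const_def using d_pos by simp

lemma card_le_local_error_const: "d * CARD('o) \<le> local_error_const"
proof -
  have "1 * real CARD('o) * 1 \<le> real k * real CARD('o) ^ Suc k * (2 * \<Lambda>\<^sup>2)"
    using k_pos card_spins_ge_1 \<Lambda>_ge_1
    by (intro mult_mono self_le_power) (auto simp: one_le_power intro: order_trans[of 1 2])
  then show ?thesis unfolding local_error_const_def using d_pos by (simp add: mult_ac)
qed

lemma bp_error_const_nonneg: "0 \<le> bp_error_const"
  by (simp add: bp_error_const_def local_error_const_nonneg)

lemma finite_vertex_pmf [simp]: "0 < n \<Longrightarrow> finite (set_pmf (vertex_pmf n))"
  by (simp add: set_pmf_of_set lessThan_empty_iff)

lemma finite_constraint_pmf: "0 < n \<Longrightarrow> finite (set_pmf (constraint_pmf n))"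
  using finite_\<rho> by (simp add: random_tuple_eq_replicate_pmf)

lemma in_constraint_pmf:
  assumes "0 < n" "b \<in> set_pmf (constraint_pmf n)"
  shows "fst b \<in> set_pmf \<rho>" "length (snd b) = k"
  using assms by (auto simp: random_tuple_eq_replicate_pmf in_set_replicate_pmf)

lemma constraint_weight_bounds:
  assumes "0 < n" "b \<in> set_pmf (constraint_pmf n)"
  shows "1 / \<Lambda> \<le> constraint_weight b \<sigma>" "constraint_weight b \<sigma> \<le> \<Lambda>" "0 < constraint_weight b \<sigma>"
proof -
  show bounds: "1 / \<Lambda> \<le> constraint_weight b \<sigma>" "constraint_weight b \<sigma> \<le> \<Lambda>"
    using weight_bounds[of "fst b" "map \<sigma> (snd b)"] in_constraint_pmf[OF assms]
    by (simp_all add: constraint_weight_def)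
  have "0 < 1 / \<Lambda>" using \<Lambda>_ge_1 by simp
  with bounds(1) show "0 < constraint_weight b \<sigma>" by linarith
qed

lemma positive_weights_constraint_pmf: "0 < n \<Longrightarrow> set G \<subseteq> set_pmf (constraint_pmf n) \<Longrightarrow> positive_weights G"
  unfolding positive_weights_def by (blast intro: constraint_weight_bounds(3))

lemma weight_of_bounds:
  assumes "0 < n" "set c \<subseteq> set_pmf (constraint_pmf n)"
  shows "1 / \<Lambda> ^ length c \<le> weight_of c \<sigma>" "weight_of c \<sigma> \<le> \<Lambda> ^ length c"
proof -
  have "1 / \<Lambda> ^ length c \<le> (\<Prod>b\<leftarrow>c. constraint_weight b \<sigma>) \<and> (\<Prod>b\<leftarrow>c. constraint_weight b \<sigma>) \<le> \<Lambda> ^ length c"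
    using constraint_weight_bounds[OF assms(1)] assms(2) by (intro prod_list_bounds \<Lambda>_ge_1) blast
  then show "1 / \<Lambda> ^ length c \<le> weight_of c \<sigma>" "weight_of c \<sigma> \<le> \<Lambda> ^ length c"
    by (simp_all add: weight_of_eq)
qed

lemma mean_constraint_weight_bounds:
  assumes "0 < n" "b \<in> set_pmf (constraint_pmf n)" "finite (set_pmf \<nu>)"
  shows "1 / \<Lambda> \<le> mean \<nu> (constraint_weight b)" "mean \<nu> (constraint_weight b) \<le> \<Lambda>"
  using mean_mono[OF assms(3), of "\<lambda>_. 1 / \<Lambda>" "constraint_weight b"]
    mean_mono[OF assms(3), of "constraint_weight b" "\<lambda>_. \<Lambda>"] constraint_weight_bounds[OF assms(1,2)]
  by auto

lemma product_error_Cons_le: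
  assumes n: "0 < n" and b: "b \<in> set_pmf (constraint_pmf n)" and c: "set c \<subseteq> set_pmf (constraint_pmf n)"
    and \<nu>: "finite (set_pmf \<nu>)"
  shows "product_error \<nu> F (b # c) \<le> product_error \<nu> (\<lambda>\<sigma>. F \<sigma> * constraint_weight b \<sigma>) c
       + \<Lambda> ^ length c * \<bar>cov \<nu> F (constraint_weight b)\<bar>"
proof -
  let ?X = "\<Prod>b\<leftarrow>c. mean \<nu> (constraint_weight b)" and ?C = "cov \<nu> F (constraint_weight b)"
  have "1 / \<Lambda> ^ length c \<le> ?X \<and> ?X \<le> \<Lambda> ^ length c"
    using mean_constraint_weight_bounds[OF n _ \<nu>] c by (intro prod_list_bounds \<Lambda>_ge_1) blast
  moreover have "0 \<le> 1 / \<Lambda> ^ length c" using \<Lambda>_ge_1 by simp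
  ultimately have X: "\<bar>?X\<bar> \<le> \<Lambda> ^ length c" by linarith
  have "product_error \<nu> F (b # c) \<le> product_error \<nu> (\<lambda>\<sigma>. F \<sigma> * constraint_weight b \<sigma>) c + \<bar>?C * ?X\<bar>"
    unfolding product_error_def cov_def weight_of_Cons by (simp add: algebra_simps)
  also have "\<bar>?C * ?X\<bar> \<le> \<Lambda> ^ length c * \<bar>?C\<bar>"
    unfolding abs_mult mult.commute[of "\<bar>?C\<bar>"] by (intro mult_right_mono X) simp
  finally show ?thesis by simp
qed

section \<open>Random constraints attached to a fixed variable\<close>

context
  fixes n x :: nat
  assumes x: "x < n"
begin

lemma n_pos: "0 < n"
  using x by simp

lemma incident_mean_tuple_le:
  assumes perm: "\<And>ys zs. mset ys = mset zs \<Longrightarrow> D ys = D zs" and D: "\<And>ys. 0 \<le> D ys"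
  shows "incident_mean n x (\<lambda>b. D (snd b)) \<le> d * mean (replicate_pmf (k - 1) (vertex_pmf n)) (\<lambda>ys. D (x # ys))"
proof -
  let ?U = "vertex_pmf n"
  let ?E = "mean (replicate_pmf (k - 1) ?U) (\<lambda>ys. D (x # ys))"
  have k: "k = Suc (k - 1)" using k_pos by simp
  have "mean (constraint_pmf n) (\<lambda>b. of_bool (incident x b) * D (snd b))
      = mean (replicate_pmf k ?U) (\<lambda>ys. of_bool (x \<in> set ys) * D ys)"
    using n_pos finite_\<rho> by (simp add: random_tuple_eq_replicate_pmf mean_pair_pmf)
  also have "\<dots> \<le> k * (pmf ?U x * ?E)"
    using mean_replicate_pmf_member_le[of ?U D "k - 1" x, OF _ perm D] n_pos
    unfolding k[symmetric] by simp
  also have "pmf ?U x = 1 / n" using x by (subst pmf_of_set) (auto simp: lessThan_empty_iff)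
  finally have "incident_mean n x (\<lambda>b. D (snd b)) \<le> d * n / k * (k * (1 / n * ?E))"
    unfolding intensity_integral_def by (rule mult_left_mono) (rule rate_nonneg)
  also have "\<dots> = d * ?E" using n_pos k_pos by simp
  finally show ?thesis .
qed

lemma incident_mean_one_le: "incident_mean n x (\<lambda>_. 1) \<le> d"
  using incident_mean_tuple_le[of "\<lambda>_. 1"] by simp

lemma incident_mean_list_one_le: "incident_mean_list n x r (\<lambda>_. 1) \<le> d ^ r"
  by (intro intensity_integral_list_one_le rate_nonneg incident_mean_one_le finite_constraint_pmf n_pos)

lemma incident_mean_sum_list_le:
  assumes "\<And>y. 0 \<le> e y" "e x = 0"
  shows "incident_mean n x (\<lambda>b. \<Sum>y\<leftarrow>snd b. e y) \<le> d * (k * mean (vertex_pmf n) e)"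
proof -
  have "incident_mean n x (\<lambda>b. \<Sum>y\<leftarrow>snd b. e y)
      \<le> d * mean (replicate_pmf (k - 1) (vertex_pmf n)) (\<lambda>ys. \<Sum>y\<leftarrow>x # ys. e y)"
    using assms
    by (intro incident_mean_tuple_le[of "\<lambda>ys. \<Sum>y\<leftarrow>ys. e y"] sum_list_nonneg)
      (auto simp flip: sum_mset_sum_list)
  also have "\<dots> = d * ((k - 1) * mean (vertex_pmf n) e)"
    using n_pos assms(2) by (simp add: mean_replicate_pmf_sum_list)
  also have "\<dots> \<le> d * (k * mean (vertex_pmf n) e)"
    using d_pos assms(1) by (intro mult_left_mono mult_right_mono mean_nonneg) auto
  finally show ?thesis .
qed

context
  fixes \<nu> :: "(nat \<Rightarrow> 'o) pmf" and s :: 'o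
  assumes finite_\<nu>: "finite (set_pmf \<nu>)" and pinned: "\<forall>\<sigma>\<in>set_pmf \<nu>. \<sigma> x = s"
begin

lemma incident_mean_dependence_le:
  assumes F: "\<And>\<sigma>. \<sigma> \<in> set_pmf \<nu> \<Longrightarrow> \<bar>F \<sigma>\<bar> \<le> K"
  shows "incident_mean n x (\<lambda>b. dependence \<nu> F (set (snd b)))
       \<le> d * (k * real CARD('o) ^ k * (K * sqrt (pair_corr (vertex_pmf n) \<nu>)))"
proof -
  let ?q = "real CARD('o)" and ?R = "K * sqrt (pair_corr (vertex_pmf n) \<nu>)"
  let ?M = "replicate_pmf (k - 1) (vertex_pmf n)"
  have K: "0 \<le> K" using F by (rule abs_bound_nonneg)
  have "incident_mean n x (\<lambda>b. dependence \<nu> F (set (snd b))) \<le> d * mean ?M (\<lambda>ys. dependence \<nu> F (set (x # ys)))"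
    by (rule incident_mean_tuple_le[of "\<lambda>ys. dependence \<nu> F (set ys)"])
      (auto dest: mset_eq_setD simp: dependence_nonneg)
  also have "mean ?M (\<lambda>ys. dependence \<nu> F (set (x # ys)))
      \<le> mean ?M (\<lambda>ys. \<Sum>t\<in>UNIV. dependence \<nu> (\<lambda>\<sigma>. F \<sigma> * spin x t \<sigma>) (set ys))"
  proof (rule mean_mono)
    show "dependence \<nu> F (set (x # ys)) \<le> (\<Sum>t\<in>UNIV. dependence \<nu> (\<lambda>\<sigma>. F \<sigma> * spin x t \<sigma>) (set ys))" for ys
      using dependence_insert_le[OF finite_\<nu>, of "set ys" F x] spin_cov_eq_0[OF pinned] by simp
  qed (simp add: n_pos)
  also have "\<dots> = (\<Sum>t\<in>UNIV. mean ?M (\<lambda>ys. dependence \<nu> (\<lambda>\<sigma>. F \<sigma> * spin x t \<sigma>) (set ys)))"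
    using n_pos by simp
  also have "\<dots> \<le> (\<Sum>t\<in>(UNIV::'o set). (k - 1) * ?q ^ (k - 1) * ?R)"
    using F K n_pos by (intro sum_mono mean_dependence_le finite_\<nu>) auto
  also have "\<dots> = (k - 1) * ?q ^ k * ?R"
    using k_pos by (simp add: power_eq_if)
  also have "\<dots> \<le> k * ?q ^ k * ?R"
    using K by (intro mult_right_mono mult_nonneg_nonneg) (auto simp: pair_corr_nonneg)
  finally show ?thesis using d_pos by simp
qed

lemma incident_mean_cov_le:
  assumes F: "\<And>\<sigma>. \<sigma> \<in> set_pmf \<nu> \<Longrightarrow> \<bar>F \<sigma>\<bar> \<le> K"
  shows "incident_mean n x (\<lambda>b. \<bar>cov \<nu> F (constraint_weight b)\<bar>)
       \<le> 2 * d * \<Lambda> * k * real CARD('o) ^ k * (K * sqrt (pair_corr (vertex_pmf n) \<nu>))"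
proof -
  let ?D = "\<lambda>F. incident_mean n x (\<lambda>b. dependence \<nu> F (set (snd b)))"
  let ?B = "\<lambda>K. d * (k * real CARD('o) ^ k * (K * sqrt (pair_corr (vertex_pmf n) \<nu>)))"
  have K: "0 \<le> K" using F by (rule abs_bound_nonneg)
  have cov_le: "\<bar>cov \<nu> F (constraint_weight b)\<bar>
      \<le> \<Lambda> * (dependence \<nu> F (set (snd b)) + K * dependence \<nu> (\<lambda>_. 1) (set (snd b)))"
    if "b \<in> set_pmf (constraint_pmf n)" for b
  proof (rule cov_local_function_le[OF finite_\<nu>])
    show "\<bar>constraint_weight b \<sigma>\<bar> \<le> \<Lambda>" for \<sigma>
      using constraint_weight_bounds[OF n_pos that, of \<sigma>] by simp
  qed (simp_all add: constraint_weight_restrict F)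
  have "incident_mean n x (\<lambda>b. \<bar>cov \<nu> F (constraint_weight b)\<bar>)
      \<le> incident_mean n x (\<lambda>b. \<Lambda> * (dependence \<nu> F (set (snd b)) + K * dependence \<nu> (\<lambda>_. 1) (set (snd b))))"
    by (intro intensity_integral_mono rate_nonneg cov_le finite_constraint_pmf n_pos)
  also have "\<dots> = \<Lambda> * (?D F + K * ?D (\<lambda>_. 1))"
    by (simp only: intensity_integral_cmult intensity_integral_add finite_constraint_pmf n_pos)
  also have "\<dots> \<le> \<Lambda> * (?B K + K * ?B 1)"
    using \<Lambda>_ge_1 K F by (intro mult_left_mono add_mono incident_mean_dependence_le) auto
  finally show ?thesis by (simp add: algebra_simps)
qed

lemma incident_mean_list_product_error_Cons_le:
  assumes b: "b \<in> set_pmf (constraint_pmf n)"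
  shows "incident_mean_list n x r (\<lambda>c. product_error \<nu> F (b # c))
       \<le> incident_mean_list n x r (product_error \<nu> (\<lambda>\<sigma>. F \<sigma> * constraint_weight b \<sigma>))
         + product_error_base ^ r * \<bar>cov \<nu> F (constraint_weight b)\<bar>"
proof -
  let ?E = "incident_mean_list n x r (product_error \<nu> (\<lambda>\<sigma>. F \<sigma> * constraint_weight b \<sigma>))"
  let ?cov = "\<bar>cov \<nu> F (constraint_weight b)\<bar>"
  have "incident_mean_list n x r (\<lambda>c. product_error \<nu> F (b # c))
      \<le> incident_mean_list n x r (\<lambda>c. product_error \<nu> (\<lambda>\<sigma>. F \<sigma> * constraint_weight b \<sigma>) c + \<Lambda> ^ r * ?cov)"
    using product_error_Cons_le[OF n_pos b _ finite_\<nu>, of _ F]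
    by (intro intensity_integral_mono zero_le_power rate_nonneg
        finite_set_replicate_pmf finite_constraint_pmf n_pos)
      (auto simp: in_set_replicate_pmf)
  also have "\<dots> = ?E + \<Lambda> ^ r * incident_mean_list n x r (\<lambda>_. 1) * ?cov"
    by (simp only: intensity_integral_add intensity_integral_const[of _ _ _ "\<Lambda> ^ r * ?cov"]
        finite_set_replicate_pmf finite_constraint_pmf n_pos mult_ac)
  also have "\<dots> \<le> ?E + product_error_base ^ r * ?cov"
  proof (intro add_left_mono mult_right_mono)
    have "\<Lambda> ^ r * incident_mean_list n x r (\<lambda>_. 1) \<le> \<Lambda> ^ r * d ^ r"
      using \<Lambda>_ge_1 by (intro mult_left_mono incident_mean_list_one_le) auto
    also have "\<dots> \<le> product_error_base ^ r"
      unfolding power_mult_distrib[symmetric]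
      using product_error_base_ge(2) \<Lambda>_ge_1 d_pos by (intro power_mono) auto
    finally show "\<Lambda> ^ r * incident_mean_list n x r (\<lambda>_. 1) \<le> product_error_base ^ r" .
  qed simp
  finally show ?thesis .
qed

lemma incident_mean_list_product_error_le:
  assumes F: "\<And>\<sigma>. \<sigma> \<in> set_pmf \<nu> \<Longrightarrow> \<bar>F \<sigma>\<bar> \<le> K"
  shows "incident_mean_list n x r (product_error \<nu> F)
       \<le> r * product_error_base ^ r * (K * sqrt (pair_corr (vertex_pmf n) \<nu>))"
  using F
proof (induction r arbitrary: F K)
  case 0
  show ?case by (simp add: product_error_def intensity_integral_def weight_of_Nil)
next
  case (Suc r)
  let ?M = product_error_base and ?R = "K * sqrt (pair_corr (vertex_pmf n) \<nu>)"
  let ?Fw = "\<lambda>b \<sigma>. F \<sigma> * constraint_weight b \<sigma>" and ?cov = "\<lambda>b. \<bar>cov \<nu> F (constraint_weight b)\<bar>"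
  have K: "0 \<le> K" using Suc.prems by (rule abs_bound_nonneg)
  have R: "0 \<le> ?R" using K by (simp add: pair_corr_nonneg)
  have M: "0 \<le> ?M ^ r" using product_error_base_ge by simp
  have IH: "incident_mean_list n x r (product_error \<nu> (?Fw b)) \<le> r * ?M ^ r * (\<Lambda> * ?R)"
    if b: "b \<in> set_pmf (constraint_pmf n)" for b
  proof -
    have "\<bar>?Fw b \<sigma>\<bar> \<le> K * \<Lambda>" if "\<sigma> \<in> set_pmf \<nu>" for \<sigma>
      unfolding abs_mult using constraint_weight_bounds[OF n_pos b, of \<sigma>] K
      by (intro mult_mono Suc.prems that) auto
    then show ?thesis using Suc.IH[of "?Fw b" "K * \<Lambda>"] by (simp add: mult_ac)
  qed
  have "incident_mean_list n x (Suc r) (product_error \<nu> F)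
      = incident_mean n x (\<lambda>b. incident_mean_list n x r (\<lambda>c. product_error \<nu> F (b # c)))"
    by (intro intensity_integral_list_Suc finite_constraint_pmf n_pos)
  also have "\<dots> \<le> incident_mean n x (\<lambda>b. r * ?M ^ r * (\<Lambda> * ?R) + ?M ^ r * ?cov b)"
    by (intro intensity_integral_mono rate_nonneg finite_constraint_pmf n_pos
        order_trans[OF incident_mean_list_product_error_Cons_le] add_right_mono IH)
  also have "\<dots> = r * ?M ^ r * (\<Lambda> * ?R) * incident_mean n x (\<lambda>_. 1) + ?M ^ r * incident_mean n x ?cov"
    by (simp only: intensity_integral_add finite_constraint_pmf n_pos
        intensity_integral_cmult[of _ _ _ "?M ^ r"]
        intensity_integral_const[of _ _ _ "r * ?M ^ r * (\<Lambda> * ?R)"])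
  also have "\<dots> \<le> r * ?M ^ r * (\<Lambda> * ?R) * d + ?M ^ r * (2 * d * \<Lambda> * k * real CARD('o) ^ k * ?R)"
    using M R \<Lambda>_ge_1 Suc.prems
    by (intro add_mono mult_left_mono incident_mean_one_le incident_mean_cov_le) auto
  also have "\<dots> \<le> Suc r * ?M ^ Suc r * ?R"
    by (rule product_error_base_Suc_ge[OF R])
  finally show ?case .
qed

end

section \<open>Messages at an isolated variable\<close>

context
  fixes G :: "'o fgraph"
  assumes G: "set G \<subseteq> set_pmf (constraint_pmf n)" "\<forall>b\<in>set G. \<not> incident x b"
begin

abbreviation (input) pinned_gibbs :: "'o \<Rightarrow> (nat \<Rightarrow> 'o) pmf" where
  "pinned_gibbs s \<equiv> pin x s (gibbs_pmf n G)"

abbreviation (input) corr_root :: real where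
  "corr_root \<equiv> sqrt (pair_corr (vertex_pmf n) (gibbs_pmf n G))"

lemma corr_root_nonneg: "0 \<le> corr_root"
  by (simp add: pair_corr_nonneg)

lemma positive_weights_G: "positive_weights G"
  by (rule positive_weights_constraint_pmf[OF n_pos G(1)])

lemma finite_set_gibbs: "finite (set_pmf (gibbs_pmf n G))"
  by (rule finite_set_gibbs_pmf[OF positive_weights_G])

lemma finite_set_pinned_gibbs: "finite (set_pmf (pinned_gibbs s))"
  by (rule finite_set_pin[OF finite_set_gibbs])

lemma set_pinned_gibbs: "\<forall>\<sigma>\<in>set_pmf (pinned_gibbs s). \<sigma> x = s"
  by (auto simp: pin_def)

lemma pair_corr_pinned_gibbs_le:
  assumes "0 \<le> K"
  shows "K * sqrt (pair_corr (vertex_pmf n) (pinned_gibbs s)) \<le> K * corr_root"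
  using assms n_pos by (intro mult_left_mono real_sqrt_le_mono pair_corr_pin_le) auto

lemma marg_Cons_isolated:
  assumes "b \<in> set_pmf (constraint_pmf n)"
  shows "marg n (b # G) x = normalized (\<lambda>s. mean (pinned_gibbs s) (constraint_weight b))"
  using marg_append_isolated[OF x _ positive_weights_G G(2), of "[b]"]
    constraint_weight_bounds(3)[OF n_pos assms]
  by (simp add: positive_weights_def weight_of_single)

lemma le_sum_mean_pinned_weight_of:
  assumes "set c \<subseteq> set_pmf (constraint_pmf n)"
  shows "1 / \<Lambda> ^ length c \<le> (\<Sum>s\<in>UNIV. mean (pinned_gibbs s) (weight_of c))"
proof -
  have lower: "1 / \<Lambda> ^ length c \<le> mean (pinned_gibbs s) (weight_of c)" for s
    using mean_mono[of "pinned_gibbs s" "\<lambda>_. 1 / \<Lambda> ^ length c" "weight_of c"]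
      finite_set_pinned_gibbs weight_of_bounds(1)[OF n_pos assms] by simp
  moreover have "0 \<le> 1 / \<Lambda> ^ length c" using \<Lambda>_ge_1 by simp
  ultimately have "0 \<le> mean (pinned_gibbs s) (weight_of c)" for s by (rule order_trans[rotated])
  then have "mean (pinned_gibbs undefined) (weight_of c) \<le> (\<Sum>s\<in>UNIV. mean (pinned_gibbs s) (weight_of c))"
    by (intro member_le_sum[of _ _ "\<lambda>s. mean (pinned_gibbs s) (weight_of c)"]) auto
  with lower show ?thesis by (rule order_trans)
qed

lemma variable_error_append_le:
  assumes c: "set c \<subseteq> set_pmf (constraint_pmf n)" "\<forall>b\<in>set c. incident x b"
  shows "variable_error n x (c @ G) \<le> \<Lambda> ^ length c * (\<Sum>s\<in>UNIV. product_error (pinned_gibbs s) (\<lambda>_. 1) c)"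
proof -
  define joint where "joint s = mean (pinned_gibbs s) (weight_of c)" for s
  define single where "single s = (\<Prod>b\<leftarrow>c. mean (pinned_gibbs s) (constraint_weight b))" for s
  define Z where "Z = (\<Prod>b\<leftarrow>c. \<Sum>t\<in>UNIV. mean (pinned_gibbs t) (constraint_weight b))"
  have pos: "0 < mean (pinned_gibbs s) (constraint_weight b)" if "b \<in> set c" for b s
  proof (rule less_le_trans)
    show "0 < 1 / \<Lambda>" using \<Lambda>_ge_1 by simp
    show "1 / \<Lambda> \<le> mean (pinned_gibbs s) (constraint_weight b)"
      using that c(1) by (intro mean_constraint_weight_bounds(1)[OF n_pos] finite_set_pinned_gibbs) auto
  qed
  have single_pos: "0 < single s" for s
    unfolding single_def using pos by (induction c) auto
  have "Z \<noteq> 0"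
    unfolding Z_def prod_list_zero_iff using pos
    by (auto simp: sum_nonneg_eq_0_iff less_imp_le order_less_imp_not_eq2)
  have "(\<Prod>b\<leftarrow>c. marg n (b # G) x s) = single s / Z" for s
  proof -
    have "(\<Prod>b\<leftarrow>c. marg n (b # G) x s)
        = (\<Prod>b\<leftarrow>c. mean (pinned_gibbs s) (constraint_weight b)
          / (\<Sum>t\<in>UNIV. mean (pinned_gibbs t) (constraint_weight b)))"
      using c(1) by (intro arg_cong[of _ _ prod_list] map_cong) (auto simp: marg_Cons_isolated normalized_def)
    then show ?thesis by (simp only: prod_list_divide single_def Z_def)
  qed
  then have "normalized (\<lambda>s. \<Prod>b\<leftarrow>c. marg n (b # G) x s) = normalized single"
    using normalized_divide_const[OF \<open>Z \<noteq> 0\<close>, of single] by simp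
  moreover have "marg n (c @ G) x = normalized joint"
    unfolding joint_def
    by (rule marg_append_isolated[OF x positive_weights_constraint_pmf[OF n_pos c(1)] positive_weights_G G(2)])
  ultimately have "variable_error n x (c @ G) = tv_dist (normalized joint) (normalized single)"
    by (simp only: variable_error_def filter_incident_append[OF c(2) G(2)])
  also have "\<dots> \<le> (\<Sum>s\<in>UNIV. \<bar>joint s - single s\<bar>) / (1 / \<Lambda> ^ length c)"
    using le_sum_mean_pinned_weight_of[OF c(1)] single_pos \<Lambda>_ge_1
    by (intro tv_dist_normalized_le sum_pos) (auto simp: joint_def less_imp_le)
  finally show ?thesis by (simp add: product_error_def joint_def single_def mult.commute)
qed

lemma mean_constraint_weight_bp_sum_diff_le:
  assumes b: "b \<in> set_pmf (constraint_pmf n)" "incident x b" and c: "set c \<subseteq> set_pmf (constraint_pmf n)"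
  shows "\<bar>mean (pinned_gibbs s) (constraint_weight b) - bp_sum b x (marg n (c @ G)) s\<bar>
       \<le> \<Lambda> * (dependence (pinned_gibbs s) (\<lambda>_. 1) (set (snd b)) + (\<Sum>y\<leftarrow>snd b. marginal_shift n x c G y))"
proof -
  let ?Y = "set (snd b)" and ?w = "constraint_weight b"
  let ?u = "\<lambda>y. if y = x then return_pmf s else marginal (gibbs_pmf n (c @ G)) y"
  let ?ind = "mean (Pi_pmf ?Y undefined (marginal (pinned_gibbs s))) ?w"
  have w: "\<bar>?w \<sigma>\<bar> \<le> \<Lambda>" for \<sigma> using constraint_weight_bounds[OF n_pos b(1), of \<sigma>] by simp
  have pos: "positive_weights (c @ G)" using c G(1) by (intro positive_weights_constraint_pmf[OF n_pos]) auto
  have "bp_sum b x (marg n (c @ G)) s = mean (Pi_pmf ?Y undefined ?u) ?w"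
    using bp_sum_eq_mean_Pi_pmf[OF b(2), of "marginal (gibbs_pmf n (c @ G))" s]
    by (simp add: marg_eq_pmf[OF pos, abs_def] fun_upd_def)
  moreover have "\<bar>mean (pinned_gibbs s) ?w - ?ind\<bar> \<le> \<Lambda> * dependence (pinned_gibbs s) (\<lambda>_. 1) ?Y"
    using mean_local_function_diff_le[of "pinned_gibbs s" ?Y ?w \<Lambda> "\<lambda>_. 1"] finite_set_pinned_gibbs w
    by (simp add: constraint_weight_restrict)
  moreover have "\<bar>?ind - mean (Pi_pmf ?Y undefined ?u) ?w\<bar> \<le> \<Lambda> * (\<Sum>y\<leftarrow>snd b. marginal_shift n x c G y)"
  proof -
    have "2 * tv_dist (pmf (marginal (pinned_gibbs s) y)) (pmf (?u y)) = marginal_shift n x c G y" for y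
      by (simp add: marginal_pin marginal_shift_def marg_eq_pmf pos positive_weights_G tv_dist_def)
    then have "\<bar>?ind - mean (Pi_pmf ?Y undefined ?u) ?w\<bar> \<le> \<Lambda> * (\<Sum>y\<in>?Y. marginal_shift n x c G y)"
      using mean_Pi_pmf_diff_le[of ?Y ?w \<Lambda> "marginal (pinned_gibbs s)" ?u] w by simp
    also have "\<dots> \<le> \<Lambda> * (\<Sum>y\<leftarrow>snd b. marginal_shift n x c G y)"
      using \<Lambda>_ge_1 by (intro mult_left_mono sum_set_le_sum_list marginal_shift_nonneg) auto
    finally show ?thesis .
  qed
  ultimately show ?thesis by (simp only: distrib_left)
qed

lemma constraint_error_append_le:
  assumes b: "b \<in> set_pmf (constraint_pmf n)" "incident x b"
    and c: "set c \<subseteq> set_pmf (constraint_pmf n)" "\<forall>b\<in>set c. incident x b"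
  shows "constraint_error n x b (c @ G) \<le> \<Lambda>\<^sup>2 * ((\<Sum>s\<in>UNIV. dependence (pinned_gibbs s) (\<lambda>_. 1) (set (snd b)))
       + CARD('o) * (\<Sum>y\<leftarrow>snd b. marginal_shift n x c G y))"
proof -
  let ?w = "constraint_weight b" and ?m = "marg n (c @ G)"
  have pos: "0 < bp_sum b x ?m s" for s
  proof -
    let ?u = "(marginal (gibbs_pmf n (c @ G)))(x := return_pmf s)"
    have "positive_weights (c @ G)" using c(1) G(1) by (intro positive_weights_constraint_pmf[OF n_pos]) auto
    from marg_eq_pmf[OF this, abs_def] have "bp_sum b x ?m s = mean (Pi_pmf (set (snd b)) undefined ?u) ?w"
      by (simp only: bp_sum_eq_mean_Pi_pmf[OF b(2)])
    moreover have "1 / \<Lambda> \<le> mean (Pi_pmf (set (snd b)) undefined ?u) ?w"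
      by (rule mean_constraint_weight_bounds(1)[OF n_pos b(1)]) simp
    ultimately show ?thesis using \<Lambda>_ge_1 by (simp add: less_le_trans[of 0 "1 / \<Lambda>"])
  qed
  have "constraint_error n x b (c @ G)
      = tv_dist (normalized (\<lambda>s. mean (pinned_gibbs s) ?w)) (normalized (bp_sum b x ?m))"
    by (simp only: constraint_error_def filter_incident_append[OF c(2) G(2)] marg_Cons_isolated[OF b(1)])
  also have "\<dots> \<le> (\<Sum>s\<in>UNIV. \<bar>mean (pinned_gibbs s) ?w - bp_sum b x ?m s\<bar>) / (1 / \<Lambda>)"
    using le_sum_mean_pinned_weight_of[of "[b]"] b(1) pos \<Lambda>_ge_1
    by (intro tv_dist_normalized_le sum_pos) (auto simp: weight_of_single less_imp_le)
  also have "\<dots> \<le> (\<Sum>s\<in>UNIV. \<Lambda> * (dependence (pinned_gibbs s) (\<lambda>_. 1) (set (snd b))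
        + (\<Sum>y\<leftarrow>snd b. marginal_shift n x c G y))) / (1 / \<Lambda>)"
    using \<Lambda>_ge_1 by (intro divide_right_mono sum_mono mean_constraint_weight_bp_sum_diff_le b c(1)) simp
  finally show ?thesis
    by (simp add: sum_distrib_left[symmetric] sum.distrib power2_eq_square mult_ac)
qed

lemma mean_marginal_shift_le:
  assumes c: "set c \<subseteq> set_pmf (constraint_pmf n)"
  shows "mean (vertex_pmf n) (marginal_shift n x c G) \<le> CARD('o) * (\<Lambda> ^ (2 * length c) * corr_root)"
proof -
  let ?\<mu> = "gibbs_pmf n G" and ?w = "weight_of c"
  have "0 < 1 / \<Lambda> ^ length c" using \<Lambda>_ge_1 by simp
  note bounds = weight_of_bounds[OF n_pos c]
  have w: "1 / \<Lambda> ^ length c \<le> mean ?\<mu> ?w"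
    using mean_mono[OF finite_set_gibbs, of "\<lambda>_. 1 / \<Lambda> ^ length c" ?w] bounds(1) by simp
  with \<open>0 < 1 / \<Lambda> ^ length c\<close> have w_pos: "0 < mean ?\<mu> ?w" by linarith
  have "marginal_shift n x c G y \<le> \<Lambda> ^ length c * spin_cov ?\<mu> ?w y" for y
  proof -
    have "positive_weights (c @ G)" using c G(1) by (intro positive_weights_constraint_pmf[OF n_pos]) auto
    then have "marg n (c @ G) y t = mean ?\<mu> (\<lambda>\<sigma>. ?w \<sigma> * spin y t \<sigma>) / mean ?\<mu> ?w" for t
      using mean_gibbs_pmf_append[OF positive_weights_constraint_pmf[OF n_pos c] positive_weights_G]
      by (simp only: marg_eq_pmf pmf_map_eq_mean)
    then have "marg n G y t - marg n (c @ G) y t = - (cov ?\<mu> ?w (spin y t) / mean ?\<mu> ?w)" for t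
      using w_pos by (simp add: marg_eq_pmf[OF positive_weights_G] pmf_map_eq_mean cov_def field_simps)
    then have "\<bar>marg n G y t - marg n (c @ G) y t\<bar> = \<bar>cov ?\<mu> ?w (spin y t)\<bar> / mean ?\<mu> ?w" for t
      using w_pos by simp
    then have "2 * tv_dist (marg n G y) (marg n (c @ G) y) = spin_cov ?\<mu> ?w y / mean ?\<mu> ?w"
      by (simp add: tv_dist_def spin_cov_def sum_divide_distrib[symmetric])
    also have "\<dots> \<le> spin_cov ?\<mu> ?w y / (1 / \<Lambda> ^ length c)"
      using w w_pos \<open>0 < 1 / \<Lambda> ^ length c\<close> by (intro divide_left_mono spin_cov_nonneg mult_pos_pos)
    finally show ?thesis
      using \<Lambda>_ge_1 by (simp add: marginal_shift_def spin_cov_nonneg mult.commute)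
  qed
  then have "mean (vertex_pmf n) (marginal_shift n x c G) \<le> \<Lambda> ^ length c * mean (vertex_pmf n) (spin_cov ?\<mu> ?w)"
    using mean_mono[of "vertex_pmf n" "marginal_shift n x c G" "\<lambda>y. \<Lambda> ^ length c * spin_cov ?\<mu> ?w y"] n_pos
    by simp
  also have "\<dots> \<le> \<Lambda> ^ length c * (CARD('o) * (\<Lambda> ^ length c * corr_root))"
  proof (intro mult_left_mono mean_spin_cov_le finite_set_gibbs finite_vertex_pmf n_pos)
    show "\<bar>?w \<sigma>\<bar> \<le> \<Lambda> ^ length c" for \<sigma>
      using bounds[of \<sigma>] \<open>0 < 1 / \<Lambda> ^ length c\<close> by linarith
  qed (use \<Lambda>_ge_1 in auto)
  finally show ?thesis by (simp add: power_mult power2_eq_square mult_ac power_mult_distrib)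
qed

lemma incident_mean_list_variable_error_le:
  "incident_mean_list n x r (\<lambda>c. variable_error n x (c @ G))
     \<le> r * real CARD('o) * (\<Lambda> * product_error_base) ^ r * corr_root"
proof -
  let ?E = "\<lambda>s. product_error (pinned_gibbs s) (\<lambda>_. 1)"
  have "incident_mean_list n x r (?E s) \<le> r * product_error_base ^ r * corr_root" for s
  proof -
    have "incident_mean_list n x r (?E s)
        \<le> r * product_error_base ^ r * (1 * sqrt (pair_corr (vertex_pmf n) (pinned_gibbs s)))"
      by (rule incident_mean_list_product_error_le[OF finite_set_pinned_gibbs set_pinned_gibbs]) auto
    also have "\<dots> \<le> r * product_error_base ^ r * (1 * corr_root)"
      using product_error_base_ge(1) by (intro mult_left_mono pair_corr_pinned_gibbs_le) auto
    finally show ?thesis by simp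
  qed
  then have "(\<Sum>s\<in>UNIV. incident_mean_list n x r (?E s))
      \<le> (\<Sum>s\<in>(UNIV::'o set). r * product_error_base ^ r * corr_root)"
    by (intro sum_mono)
  then have total: "(\<Sum>s\<in>UNIV. incident_mean_list n x r (?E s))
      \<le> CARD('o) * (r * product_error_base ^ r * corr_root)"
    by simp
  have "incident_mean_list n x r (\<lambda>c. variable_error n x (c @ G))
      \<le> incident_mean_list n x r (\<lambda>c. \<Lambda> ^ r * (\<Sum>s\<in>UNIV. ?E s c))"
    using variable_error_append_le
    by (intro intensity_integral_mono zero_le_power rate_nonneg
        finite_set_replicate_pmf finite_constraint_pmf n_pos)
      (auto simp: in_set_replicate_pmf)
  also have "\<dots> = \<Lambda> ^ r * (\<Sum>s\<in>UNIV. incident_mean_list n x r (?E s))"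
    by (simp only: intensity_integral_cmult intensity_integral_sum
        finite_set_replicate_pmf finite_constraint_pmf n_pos)
  also have "\<dots> \<le> \<Lambda> ^ r * (CARD('o) * (r * product_error_base ^ r * corr_root))"
    using total \<Lambda>_ge_1 by (intro mult_left_mono) auto
  finally show ?thesis by (simp add: power_mult_distrib mult_ac)
qed

lemma incident_mean_marginal_shift_le:
  assumes c: "set c \<subseteq> set_pmf (constraint_pmf n)"
  shows "incident_mean n x (\<lambda>b. \<Sum>y\<leftarrow>snd b. marginal_shift n x c G y)
       \<le> d * (k * real CARD('o) ^ k * (\<Lambda> ^ (2 * length c) * corr_root))"
proof -
  let ?q = "real CARD('o)" and ?L = "\<Lambda> ^ (2 * length c)"
  have "incident_mean n x (\<lambda>b. \<Sum>y\<leftarrow>snd b. marginal_shift n x c G y)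
      \<le> d * (k * mean (vertex_pmf n) (marginal_shift n x c G))"
    by (intro incident_mean_sum_list_le marginal_shift_nonneg) (simp add: marginal_shift_def)
  also have "\<dots> \<le> d * (k * (?q * (?L * corr_root)))"
    using d_pos by (intro mult_left_mono mean_marginal_shift_le c) auto
  also have "\<dots> \<le> d * (k * (?q ^ k * (?L * corr_root)))"
    using d_pos k_pos \<Lambda>_ge_1 corr_root_nonneg card_spins_ge_1
    by (intro mult_left_mono mult_right_mono self_le_power mult_nonneg_nonneg) auto
  finally show ?thesis by (simp only: mult_ac)
qed

lemma incident_mean_constraint_error_le:
  assumes c: "set c \<subseteq> set_pmf (constraint_pmf n)" "\<forall>b\<in>set c. incident x b"
  shows "incident_mean n x (\<lambda>b. constraint_error n x b (c @ G))
       \<le> local_error_const * (\<Lambda> ^ (2 * length c) * corr_root)"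
proof -
  let ?q = "real CARD('o)" and ?L = "\<Lambda> ^ (2 * length c)"
  let ?dep = "\<lambda>s b. dependence (pinned_gibbs s) (\<lambda>_. 1) (set (snd b))"
  let ?shift = "\<lambda>b. \<Sum>y\<leftarrow>snd b. marginal_shift n x c G y"
  let ?B = "d * (k * ?q ^ k * (?L * corr_root))"
  have L: "1 \<le> ?L" using \<Lambda>_ge_1 by (simp add: one_le_power)
  have dep: "incident_mean n x (?dep s) \<le> ?B" for s
  proof -
    have "incident_mean n x (?dep s)
        \<le> d * (k * ?q ^ k * (1 * sqrt (pair_corr (vertex_pmf n) (pinned_gibbs s))))"
      by (rule incident_mean_dependence_le[OF finite_set_pinned_gibbs set_pinned_gibbs]) auto
    also have "\<dots> \<le> d * (k * ?q ^ k * (1 * corr_root))"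
      using d_pos by (intro mult_left_mono pair_corr_pinned_gibbs_le) auto
    also have "\<dots> \<le> ?B"
      using d_pos L corr_root_nonneg by (intro mult_left_mono mult_right_mono) auto
    finally show ?thesis .
  qed
  have "incident_mean n x (\<lambda>b. constraint_error n x b (c @ G))
      \<le> incident_mean n x (\<lambda>b. \<Lambda>\<^sup>2 * ((\<Sum>s\<in>UNIV. ?dep s b) + ?q * ?shift b))"
    by (intro intensity_integral_mono rate_nonneg finite_constraint_pmf n_pos constraint_error_append_le c)
  also have "\<dots> = \<Lambda>\<^sup>2 * ((\<Sum>s\<in>UNIV. incident_mean n x (?dep s)) + ?q * incident_mean n x ?shift)"
    by (simp only: intensity_integral_cmult intensity_integral_add intensity_integral_sum
        finite_constraint_pmf n_pos)
  also have "\<dots> \<le> \<Lambda>\<^sup>2 * ((\<Sum>s\<in>(UNIV::'o set). ?B) + ?q * ?B)"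
    by (intro mult_left_mono add_mono sum_mono dep incident_mean_marginal_shift_le c(1)) auto
  finally show ?thesis by (simp add: local_error_const_def algebra_simps)
qed

lemma incident_mean_local_error_le:
  assumes c: "set c \<subseteq> set_pmf (constraint_pmf n)" "\<forall>b\<in>set c. incident x b"
  shows "incident_mean n x (\<lambda>b. local_error n x b (c @ G))
       \<le> d * variable_error n x (c @ G) + local_error_const * (\<Lambda> ^ (2 * length c) * corr_root)"
proof -
  let ?v = "variable_error n x (c @ G)"
  have "incident_mean n x (\<lambda>b. local_error n x b (c @ G))
      = ?v * incident_mean n x (\<lambda>_. 1) + incident_mean n x (\<lambda>b. constraint_error n x b (c @ G))"
    by (simp only: local_error_def intensity_integral_add finite_constraint_pmf
        n_pos intensity_integral_const[of _ _ _ ?v])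
  also have "\<dots> \<le> ?v * d + local_error_const * (\<Lambda> ^ (2 * length c) * corr_root)"
    using incident_mean_one_le
    by (intro add_mono mult_left_mono incident_mean_constraint_error_le c)
      (auto simp: variable_error_def tv_dist_nonneg)
  finally show ?thesis by (simp only: mult.commute)
qed

lemma incident_mean_list_local_error_le:
  "incident_mean_list n x r (\<lambda>c. incident_mean n x (\<lambda>b. local_error n x b (c @ G)))
     \<le> local_error_const * (2 * \<Lambda> * product_error_base) ^ r * corr_root"
proof -
  let ?D = local_error_const and ?B = "(\<Lambda> * product_error_base) ^ r * corr_root"
  let ?s = "?D * (\<Lambda> ^ (2 * r) * corr_root)"
  have B: "0 \<le> ?B"
    using \<Lambda>_ge_1 product_error_base_ge(1) by (intro mult_nonneg_nonneg corr_root_nonneg) auto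
  have "incident_mean_list n x r (\<lambda>c. incident_mean n x (\<lambda>b. local_error n x b (c @ G)))
      \<le> incident_mean_list n x r (\<lambda>c. d * variable_error n x (c @ G) + ?s)"
    using incident_mean_local_error_le
    by (intro intensity_integral_mono zero_le_power rate_nonneg
        finite_set_replicate_pmf finite_constraint_pmf n_pos)
      (auto simp: in_set_replicate_pmf)
  also have "\<dots> = d * incident_mean_list n x r (\<lambda>c. variable_error n x (c @ G))
      + ?s * incident_mean_list n x r (\<lambda>_. 1)"
    by (simp only: intensity_integral_add intensity_integral_cmult[of _ _ _ d]
        intensity_integral_const[of _ _ _ ?s] finite_set_replicate_pmf finite_constraint_pmf n_pos)
  also have "\<dots> \<le> d * (r * real CARD('o) * (\<Lambda> * product_error_base) ^ r * corr_root) + ?s * d ^ r"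
    using d_pos \<Lambda>_ge_1
    by (intro add_mono mult_left_mono incident_mean_list_variable_error_le incident_mean_list_one_le
        mult_nonneg_nonneg local_error_const_nonneg corr_root_nonneg) auto
  also have "\<dots> = (d * CARD('o)) * (r * ?B) + ?D * ((\<Lambda> ^ (2 * r) * d ^ r) * corr_root)"
    by (simp only: mult_ac)
  also have "\<dots> \<le> ?D * (r * ?B) + ?D * ?B"
    using B
    by (intro add_mono mult_left_mono mult_right_mono card_le_local_error_const power_le_product_error_base
        local_error_const_nonneg corr_root_nonneg) auto
  also have "\<dots> = ?D * ((r + 1) * ?B)" by (simp add: algebra_simps)
  also have "\<dots> \<le> ?D * (2 ^ r * ?B)"
  proof (intro mult_left_mono mult_right_mono B local_error_const_nonneg)
    show "real (r + 1) \<le> 2 ^ r" using of_nat_mono[OF Suc_leI[OF less_exp[of r]], where 'a = real] by simp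
  qed
  finally show ?thesis by (simp add: power_mult_distrib mult_ac)
qed

end

end

end

section \<open>The expected Belief Propagation error\<close>

definition rs_deviation :: "real \<Rightarrow> nat \<Rightarrow> 'o::finite weight pmf \<Rightarrow> nat \<Rightarrow> real" where
  "rs_deviation d k \<rho> n = 1 / (real n)\<^sup>2 * (\<Sum>i<n. \<Sum>j<n. mean (random_fgraph d k \<rho> n)
     (\<lambda>G. tv_dist (marg2 n G i j) (\<lambda>(s, t). marg n G i s * marg n G j t)))"

lemma rs_deviation_nonneg: "0 \<le> rs_deviation d k \<rho> n"
  unfolding rs_deviation_def by (intro mult_nonneg_nonneg sum_nonneg mean_nonneg tv_dist_nonneg) auto

context bounded_weights
begin

lemma nn_integral_sqrt_pair_corr_le:
  assumes n: "0 < n"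
  shows "(\<integral>\<^sup>+G. ennreal (sqrt (pair_corr (vertex_pmf n) (gibbs_pmf n G))) \<partial>random_fgraph d k \<rho> n)
       \<le> ennreal (sqrt (2 * rs_deviation d k \<rho> n))"
proof -
  let ?M = "random_fgraph d k \<rho> n"
  let ?\<delta> = "\<lambda>G. pair_corr (vertex_pmf n) (gibbs_pmf n G)"
  let ?tv = "\<lambda>i j G. tv_dist (marg2 n G i j) (\<lambda>(s, t). marg n G i s * marg n G j t)"
  have pos: "positive_weights G" if "G \<in> set_pmf ?M" for G
    using that n by (intro positive_weights_constraint_pmf set_poisson_list_pmf) (auto simp: random_fgraph_eq)
  have tv: "integrable (measure_pmf ?M) (?tv i j)" for i j
    using pos by (intro measure_pmf.integrable_const_bound[where B = 1])
      (auto simp: AE_measure_pmf_iff tv_dist_marg2_le_1 tv_dist_nonneg)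
  have \<delta>_eq: "?\<delta> G = 2 / (real n)\<^sup>2 * (\<Sum>i<n. \<Sum>j<n. ?tv i j G)" if "G \<in> set_pmf ?M" for G
    by (rule pair_corr_gibbs_pmf[OF n pos[OF that]])
  have "integrable (measure_pmf ?M) (\<lambda>G. 2 / (real n)\<^sup>2 * (\<Sum>i<n. \<Sum>j<n. ?tv i j G))"
    using tv by simp
  then have \<delta>: "integrable (measure_pmf ?M) ?\<delta>"
    by (rule integrable_cong_AE_imp) (auto simp: AE_measure_pmf_iff \<delta>_eq)
  have "mean ?M ?\<delta> = mean ?M (\<lambda>G. 2 / (real n)\<^sup>2 * (\<Sum>i<n. \<Sum>j<n. ?tv i j G))"
    by (rule mean_cong) (rule \<delta>_eq)
  also have "\<dots> = 2 * rs_deviation d k \<rho> n"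
    using tv by (simp add: rs_deviation_def)
  finally have mean_\<delta>: "mean ?M ?\<delta> = 2 * rs_deviation d k \<rho> n" .
  have square: "integrable (measure_pmf ?M) (\<lambda>G. (sqrt (?\<delta> G))\<^sup>2)"
    using \<delta> by (simp add: pair_corr_nonneg)
  then have "integrable (measure_pmf ?M) (\<lambda>G. sqrt (?\<delta> G))"
    by (rule measure_pmf.square_integrable_imp_integrable[rotated]) simp
  then have "(\<integral>\<^sup>+G. ennreal (sqrt (?\<delta> G)) \<partial>?M) = ennreal (mean ?M (\<lambda>G. sqrt (?\<delta> G)))"
    by (intro nn_integral_eq_integral) (simp_all add: pair_corr_nonneg)
  also have "\<dots> \<le> ennreal (sqrt (2 * rs_deviation d k \<rho> n))"
    using mean_le_sqrt_mean_square[OF square] by (intro ennreal_leI) (simp add: pair_corr_nonneg mean_\<delta>)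
  finally show ?thesis .
qed

lemma nn_integral_local_error_le:
  assumes x: "x < n"
  shows "(\<integral>\<^sup>+G. ennreal (\<Sum>a\<in>adj_var G x. local_error n x (G ! a) (delete_nth a G)) \<partial>random_fgraph d k \<rho> n)
       \<le> ennreal (local_error_const * exp (2 * \<Lambda> * product_error_base) * sqrt (2 * rs_deviation d k \<rho> n))"
proof -
  let ?M = "random_fgraph d k \<rho> n" and ?l = "d * n / k"
  let ?z = "2 * \<Lambda> * product_error_base"
  have n: "0 < n" using x by simp
  have l: "0 < ?l" using n d_pos k_pos by simp
  have z: "0 \<le> ?z" using \<Lambda>_ge_1 product_error_base_ge(1) by simp
  have series: "(\<lambda>r. local_error_const * ?z ^ r / fact r) sums (local_error_const * exp ?z)"
    using sums_mult[OF exp_converges[of ?z], of local_error_const] by (simp add: field_simps)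
  have "(\<integral>\<^sup>+G. ennreal (\<Sum>a\<in>adj_var G x. local_error n x (G ! a) (delete_nth a G)) \<partial>?M)
      = (\<integral>\<^sup>+G. ennreal (incident_mean n x (\<lambda>b. local_error n x b G)) \<partial>?M)"
    unfolding random_fgraph_eq adj_var_def
    by (rule nn_integral_poisson_sum_intensity_integral[OF l finite_constraint_pmf[OF n] local_error_nonneg])
  also have "\<dots> \<le> ennreal (local_error_const * exp ?z)
      * (\<integral>\<^sup>+G. ennreal (sqrt (pair_corr (vertex_pmf n) (gibbs_pmf n G))) \<partial>?M)"
    unfolding random_fgraph_eq
  proof (rule nn_integral_poisson_list_pmf_le[OF l finite_constraint_pmf[OF n] _ _ _ _ _ series])
    show "incident_mean n x (\<lambda>b. local_error n x b G) = incident_mean n x (\<lambda>b. local_error n x b H)"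
      if "mset G = mset H" for G H
      by (simp only: local_error_perm[OF that])
    show "0 \<le> incident_mean n x (\<lambda>b. local_error n x b G)" for G
      by (intro intensity_integral_nonneg rate_nonneg local_error_nonneg)
    show "incident_mean_list n x r (\<lambda>c. incident_mean n x (\<lambda>b. local_error n x b (c @ G)))
        \<le> local_error_const * ?z ^ r * sqrt (pair_corr (vertex_pmf n) (gibbs_pmf n G))"
      if "set G \<subseteq> set_pmf (constraint_pmf n)" "\<forall>b\<in>set G. \<not> incident x b" for r G
      by (rule incident_mean_list_local_error_le[OF x that])
  qed (use z local_error_const_nonneg in \<open>auto simp: pair_corr_nonneg\<close>)
  also have "\<dots> \<le> ennreal (local_error_const * exp ?z) * ennreal (sqrt (2 * rs_deviation d k \<rho> n))"
    by (intro mult_left_mono nn_integral_sqrt_pair_corr_le n) simp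
  finally show ?thesis
    using local_error_const_nonneg rs_deviation_nonneg[of d k \<rho> n] by (simp add: ennreal_mult[symmetric])
qed

theorem nn_integral_bp_error_le:
  assumes n: "0 < n"
  shows "(\<integral>\<^sup>+G. ennreal (bp_error n G / n) \<partial>random_fgraph d k \<rho> n)
       \<le> ennreal (bp_error_const * sqrt (2 * rs_deviation d k \<rho> n))"
proof -
  let ?M = "random_fgraph d k \<rho> n" and ?R = "sqrt (2 * rs_deviation d k \<rho> n)"
  let ?S = "\<lambda>x G. \<Sum>a\<in>adj_var G x. local_error n x (G ! a) (delete_nth a G)"
  have "ennreal (bp_error n G / n) = ennreal (2 / real n) * (\<Sum>x<n. ennreal (?S x G))"
    for G :: "'o fgraph"
    unfolding bp_error_eq local_error_def[symmetric]
    by (simp add: sum_ennreal sum_nonneg local_error_nonneg ennreal_mult'[symmetric])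
  then have "(\<integral>\<^sup>+G. ennreal (bp_error n G / n) \<partial>?M)
      = (\<integral>\<^sup>+G. ennreal (2 / real n) * (\<Sum>x<n. ennreal (?S x G)) \<partial>?M)"
    by (simp only:)
  also have "\<dots> = ennreal (2 / real n) * (\<Sum>x<n. \<integral>\<^sup>+G. ennreal (?S x G) \<partial>?M)"
    by (subst nn_integral_cmult, simp) (subst nn_integral_sum, simp_all)
  also have "\<dots> \<le> ennreal (2 / real n)
      * (\<Sum>x<n. ennreal (local_error_const * exp (2 * \<Lambda> * product_error_base) * ?R))"
    by (intro mult_left_mono sum_mono nn_integral_local_error_le) auto
  also have "\<dots> = ennreal (bp_error_const * ?R)"
    using n local_error_const_nonneg rs_deviation_nonneg[of d k \<rho> n]
    by (simp add: bp_error_const_def sum_ennreal ennreal_mult[symmetric] ennreal_of_nat_eq_real_of_nat)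
  finally show ?thesis .
qed

end

section \<open>From vanishing expectation to high probability\<close>

lemma prob_less_ge:
  fixes f :: "'a \<Rightarrow> real"
  assumes E: "(\<integral>\<^sup>+z. ennreal (f z) \<partial>measure_pmf p) \<le> ennreal (c\<^sup>2)" and c: "0 < c"
  shows "1 - c \<le> measure_pmf.prob p {z. f z < c}"
proof -
  have "emeasure p {z\<in>UNIV. 1 \<le> ennreal (1 / c) * ennreal (f z)}
      \<le> ennreal (1 / c) * (\<integral>\<^sup>+z. ennreal (f z) * indicator UNIV z \<partial>p)"
    by (rule nn_integral_Markov_inequality) auto
  also have "\<dots> \<le> ennreal (1 / c) * ennreal (c\<^sup>2)"
    using E by (intro mult_left_mono) auto
  also have "\<dots> = ennreal c" using c by (simp add: ennreal_mult'[symmetric] power2_eq_square)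
  also have "{z\<in>UNIV. 1 \<le> ennreal (1 / c) * ennreal (f z)} = {z. c \<le> f z}"
    using c by (auto simp: ennreal_mult'[symmetric])
  finally have "measure_pmf.prob p {z. c \<le> f z} \<le> c"
    using c by (simp add: measure_pmf.emeasure_eq_measure)
  moreover have "measure_pmf.prob p {z. f z < c} = 1 - measure_pmf.prob p {z. c \<le> f z}"
    using measure_pmf.prob_compl[of "{z. c \<le> f z}" p]
    by (simp add: Compl_eq_Diff_UNIV[symmetric] Collect_neg_eq[symmetric] not_le)
  ultimately show ?thesis by linarith
qed

lemma vanishing_expectation_imp_high_probability:
  fixes p :: "nat \<Rightarrow> 'a pmf" and f :: "nat \<Rightarrow> 'a \<Rightarrow> real"
  assumes E: "\<forall>\<^sub>F n in sequentially. (\<integral>\<^sup>+z. ennreal (f n z) \<partial>p n) \<le> ennreal (B n)"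
    and B: "B \<longlonglongrightarrow> 0" "\<And>n. 0 \<le> B n"
  obtains \<epsilon> where "\<epsilon> \<longlonglongrightarrow> 0" "(\<lambda>n. measure_pmf.prob (p n) {z. f n z < \<epsilon> n}) \<longlonglongrightarrow> 1"
proof
  let ?\<epsilon> = "\<lambda>n. sqrt (B n + 1 / Suc n)"
  have "(\<lambda>n. B n + 1 / Suc n) \<longlonglongrightarrow> 0 + 0"
    by (intro tendsto_add B(1) LIMSEQ_Suc[OF lim_1_over_n])
  from tendsto_real_sqrt[OF this] show \<epsilon>: "?\<epsilon> \<longlonglongrightarrow> 0" by simp
  show "(\<lambda>n. measure_pmf.prob (p n) {z. f n z < ?\<epsilon> n}) \<longlonglongrightarrow> 1"
  proof (rule tendsto_sandwich)
    show "\<forall>\<^sub>F n in sequentially. 1 - ?\<epsilon> n \<le> measure_pmf.prob (p n) {z. f n z < ?\<epsilon> n}"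
      using E
    proof eventually_elim
      case (elim n)
      have "B n \<le> (?\<epsilon> n)\<^sup>2" "0 < ?\<epsilon> n" using B(2)[of n] by (simp_all add: add_nonneg_pos)
      then show ?case using elim by (intro prob_less_ge) (auto intro: order_trans ennreal_leI)
    qed
    show "(\<lambda>n. 1 - ?\<epsilon> n) \<longlonglongrightarrow> 1" using tendsto_diff[OF tendsto_const \<epsilon>, of 1] by simp
  qed auto
qed

theorem (in bounded_weights) bp_fixed_point_with_high_probability:
  assumes "rs_deviation d k \<rho> \<longlonglongrightarrow> 0"
  shows "\<exists>\<epsilon>. \<epsilon> \<longlonglongrightarrow> 0 \<and>
    (\<lambda>n. measure_pmf.prob (random_fgraph d k \<rho> n) {G. is_eps_BP_fixed_point n G (\<epsilon> n)}) \<longlonglongrightarrow> 1"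
proof -
  let ?B = "\<lambda>n. bp_error_const * sqrt (2 * rs_deviation d k \<rho> n)"
  have "?B \<longlonglongrightarrow> bp_error_const * sqrt (2 * 0)" by (intro tendsto_intros assms)
  then have B: "?B \<longlonglongrightarrow> 0" by simp
  have nonneg: "0 \<le> ?B n" for n using bp_error_const_nonneg rs_deviation_nonneg[of d k \<rho> n] by simp
  have E: "\<forall>\<^sub>F n in sequentially.
      (\<integral>\<^sup>+G. ennreal (bp_error n G / n) \<partial>random_fgraph d k \<rho> n) \<le> ennreal (?B n)"
    using nn_integral_bp_error_le by (rule eventually_sequentiallyI[of 1]) simp
  obtain \<epsilon> where \<epsilon>: "\<epsilon> \<longlonglongrightarrow> 0"
    "(\<lambda>n. measure_pmf.prob (random_fgraph d k \<rho> n) {G. bp_error n G / n < \<epsilon> n}) \<longlonglongrightarrow> 1"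
    by (rule vanishing_expectation_imp_high_probability[OF E B nonneg])
  have "\<forall>\<^sub>F n in sequentially. measure_pmf.prob (random_fgraph d k \<rho> n) {G. bp_error n G / n < \<epsilon> n}
      = measure_pmf.prob (random_fgraph d k \<rho> n) {G. is_eps_BP_fixed_point n G (\<epsilon> n)}"
    using eventually_gt_at_top[of 0]
    by eventually_elim (simp add: is_eps_BP_fixed_point_def pos_divide_less_eq)
  with \<epsilon> show ?thesis by (blast intro: Lim_transform_eventually)
qed

lemma positive_weights_bounded:
  fixes \<Psi> :: "('o::finite) weight set"
  assumes "finite \<Psi>" "\<And>\<psi> \<tau>. \<psi> \<in> \<Psi> \<Longrightarrow> length \<tau> = k \<Longrightarrow> 0 < \<psi> \<tau>"
  obtains \<Lambda> where "1 \<le> \<Lambda>" "\<And>\<psi> \<tau>. \<psi> \<in> \<Psi> \<Longrightarrow> length \<tau> = k \<Longrightarrow> 1 / \<Lambda> \<le> \<psi> \<tau> \<and> \<psi> \<tau> \<le> \<Lambda>"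
proof
  let ?V = "(\<lambda>(\<psi>, \<tau>). max (\<psi> \<tau>) (1 / \<psi> \<tau>)) ` (\<Psi> \<times> {\<tau> :: 'o list. length \<tau> = k})"
  let ?\<Lambda> = "Max (insert 1 ?V)"
  have V: "finite (insert 1 ?V)"
    using assms(1) finite_lists_length_eq[of "UNIV :: 'o set" k] by simp
  then show "1 \<le> ?\<Lambda>" by simp
  fix \<psi> and \<tau> :: "'o list" assume \<psi>\<tau>: "\<psi> \<in> \<Psi>" "length \<tau> = k"
  then have "max (\<psi> \<tau>) (1 / \<psi> \<tau>) \<in> insert 1 ?V" by force
  then have "max (\<psi> \<tau>) (1 / \<psi> \<tau>) \<le> ?\<Lambda>" using V by (rule Max_ge[rotated])
  then show "1 / ?\<Lambda> \<le> \<psi> \<tau> \<and> \<psi> \<tau> \<le> ?\<Lambda>"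
    using assms(2)[OF \<psi>\<tau>] \<open>1 \<le> ?\<Lambda>\<close> by (simp add: field_simps)
qed

theorem theorem1:
  fixes d :: real and k :: nat
    and \<Psi> :: "('o::finite) weight set" and \<rho> :: "'o weight pmf"
  assumes "d > 0" and "k \<ge> 3"
    and "finite \<Psi>" and "\<Psi> \<noteq> {}"
    and "\<And>\<psi> \<tau>. \<psi> \<in> \<Psi> \<Longrightarrow> length \<tau> = k \<Longrightarrow> \<psi> \<tau> > 0"
    and "set_pmf \<rho> \<subseteq> \<Psi>"
    and RS: "(\<lambda>n. (1 / (real n)^2) *
              (\<Sum>i<n. \<Sum>j<n. measure_pmf.expectation (random_fgraph d k \<rho> n)
                 (\<lambda>G. tv_dist (marg2 n G i j) (\<lambda>(s, t). marg n G i s * marg n G j t))))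
            \<longlonglongrightarrow> 0"
  shows "\<exists>\<epsilon> :: nat \<Rightarrow> real. \<epsilon> \<longlonglongrightarrow> 0 \<and>
           (\<lambda>n. measure_pmf.prob (random_fgraph d k \<rho> n)
                  {G. is_eps_BP_fixed_point n G (\<epsilon> n)}) \<longlonglongrightarrow> 1"
proof -
  obtain \<Lambda> where \<Lambda>: "1 \<le> \<Lambda>" "\<And>\<psi> \<tau>. \<psi> \<in> \<Psi> \<Longrightarrow> length \<tau> = k \<Longrightarrow> 1 / \<Lambda> \<le> \<psi> \<tau> \<and> \<psi> \<tau> \<le> \<Lambda>"
    by (rule positive_weights_bounded[OF assms(3)]) (use assms(5) in auto)
  interpret bounded_weights k d \<Lambda> \<rho>
    using assms(1,2,6) \<Lambda> finite_subset[OF assms(6,3)] by unfold_locales auto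
  have "rs_deviation d k \<rho> \<longlonglongrightarrow> 0" using RS unfolding rs_deviation_def[abs_def] .
  then show ?thesis by (rule bp_fixed_point_with_high_probability)
qed

end
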